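(* Let $n\ge 1$. Every $B_K$-orbit of $\mathrm{Gr}_n(\mathbb{C}^{2n})$ is of the form $B_K\cdot(\operatorname{Im}\omega)$ for some $\omega\in(\mathfrak{T}_n^2)'$. Moreover, $\omega,\omega'\in(\mathfrak{T}_n^2)'$ represent the same $B_K$-orbit (that is, $B_K\cdot \operatorname{Im}\omega=B_K\cdot\operatorname{Im}\omega'$) if and only if they coincide up to column permutation. Thus $\omega\mapsto B_K\cdot\operatorname{Im}\omega$ induces a bijection $(\mathfrak{T}_n^2)'/\mathfrak{S}_n\simeq \mathrm{Gr}_n(\mathbb{C}^{2n})/B_K\cong\mathfrak{X}/K$.
   Context: Work over $\mathbb{C}$. Let $G=\mathrm{GL}_{2n}(\mathbb{C})$ and let $K\cong\mathrm{GL}_n(\mathbb{C})\times\mathrm{GL}_n(\mathbb{C})$ be the subgroup of block diagonal matrices with two $n\times n$ blocks. Let $B\subset\mathrm{GL}_n(\mathbb{C})$ be the Borel subgroup of upper triangular matrices and $B_K=B\times B\subset K$ (block diagonal). Let $P_{\mathrm S}\subset G$ be the stabilizer of $\mathbb{C}^n\oplus\{0\}\subset\mathbb{C}^{2n}$, so that $G/P_{\mathrm S}\cong\mathrm{Gr}_n(\mathbb{C}^{2n})$, the Grassmannian of $n$-dimensional subspaces of $\mathbb{C}^{2n}$, on which $K$ and $B_K$ act. Put $\mathfrak{X}=K/B_K\times G/P_{\mathrm S}$ with the diagonal $K$-action; the identification $\mathrm{Gr}_n(\mathbb{C}^{2n})/B_K\cong\mathfrak{X}/K$ sends the $B_K$-orbit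 of $W$ to the $K$-orbit of $(B_K,W)$. A partial permutation is an $n\times n$ matrix with entries in $\{0,1\}$ having at most one nonzero entry in each row and in each column; $\mathfrak{T}_n$ is the set of partial permutations. $(\mathfrak{T}_n^2)'$ is the set of $(2n)\times n$ matrices $\omega=\begin{pmatrix}\tau_1\\ \tau_2\end{pmatrix}$ with $\tau_1,\tau_2\in\mathfrak{T}_n$ and $\operatorname{rank}\omega=n$. $\operatorname{Im}\omega\subset\mathbb{C}^{2n}$ is the span of the columns of $\omega$. The symmetric group $\mathfrak{S}_n$ acts on $(\mathfrak{T}_n^2)'$ by permutation of columns (right multiplication by permutation matrices). *)

theory Defs
  imports
    "Jordan_Normal_Form.DL_Rank"
    "HOL-Algebra.Group_Action"
    "HOL-Algebra.Left_Coset"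
    "HOL-Combinatorics.Permutations"
begin

definition GL :: "nat \<Rightarrow> complex mat monoid" where
  "GL m = units_of (ring_mat TYPE(complex) m ())"

definition block_diag :: "nat \<Rightarrow> complex mat \<Rightarrow> complex mat \<Rightarrow> complex mat" where
  "block_diag n a b = four_block_mat a (0\<^sub>m n n) (0\<^sub>m n n) b"

definition K_set :: "nat \<Rightarrow> complex mat set" where
  "K_set n = {block_diag n a b | a b. a \<in> carrier (GL n) \<and> b \<in> carrier (GL n)}"

definition Borel :: "nat \<Rightarrow> complex mat set" where
  "Borel n = {b \<in> carrier (GL n). upper_triangular b}"

definition BK_set :: "nat \<Rightarrow> complex mat set" where
  "BK_set n = {block_diag n a b | a b. a \<in> Borel n \<and> b \<in> Borel n}"

abbreviation K_grp :: "nat \<Rightarrow> complex mat monoid" where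
  "K_grp n \<equiv> (GL (n + n))\<lparr>carrier := K_set n\<rparr>"

abbreviation BK_grp :: "nat \<Rightarrow> complex mat monoid" where
  "BK_grp n \<equiv> (GL (n + n))\<lparr>carrier := BK_set n\<rparr>"

definition act :: "complex mat \<Rightarrow> complex vec set \<Rightarrow> complex vec set" where
  "act g W = (\<lambda>v. g *\<^sub>v v) ` W"

definition Gr :: "nat \<Rightarrow> nat \<Rightarrow> complex vec set set" where
  "Gr k m = {W. VectorSpace.subspace class_ring W (module_vec TYPE(complex) m) \<and>
     vectorspace.dim class_ring ((module_vec TYPE(complex) m)\<lparr>carrier := W\<rparr>) = k}"

definition std_sub :: "nat \<Rightarrow> complex vec set" where
  "std_sub n = {u @\<^sub>v 0\<^sub>v n | u. u \<in> carrier_vec n}"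

definition P_S :: "nat \<Rightarrow> complex mat set" where
  "P_S n = stabilizer (GL (n + n)) act (std_sub n)"

definition XX :: "nat \<Rightarrow> (complex mat set \<times> complex mat set) set" where
  "XX n = (lcosets\<^bsub>K_grp n\<^esub> (BK_set n)) \<times> (lcosets\<^bsub>GL (n + n)\<^esub> (P_S n))"

definition act_XX :: "nat \<Rightarrow> complex mat \<Rightarrow> complex mat set \<times> complex mat set
    \<Rightarrow> complex mat set \<times> complex mat set" where
  "act_XX n k = (\<lambda>(C, D). (k <#\<^bsub>K_grp n\<^esub> C, k <#\<^bsub>GL (n + n)\<^esub> D))"

text \<open>The coset in \<open>G/P\<^sub>S\<close> that corresponds to the subspace \<open>W\<close> under
  \<open>g P\<^sub>S \<mapsto> g (\<complex>\<^sup>n \<oplus> 0)\<close>; see \<open>coset_of_act_std_sub\<close> below.\<close>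

definition coset_of :: "nat \<Rightarrow> complex vec set \<Rightarrow> complex mat set" where
  "coset_of n W = {g \<in> carrier (GL (n + n)). act g (std_sub n) = W}"

definition partial_perms :: "nat \<Rightarrow> complex mat set" where
  "partial_perms n = {\<tau> \<in> carrier_mat n n.
     (\<forall>i<n. \<forall>j<n. \<tau> $$ (i, j) \<in> {0, 1}) \<and>
     (\<forall>i<n. card {j. j < n \<and> \<tau> $$ (i, j) \<noteq> 0} \<le> 1) \<and>
     (\<forall>j<n. card {i. i < n \<and> \<tau> $$ (i, j) \<noteq> 0} \<le> 1)}"

definition pp_pairs :: "nat \<Rightarrow> complex mat set" where
  "pp_pairs n = {\<tau>\<^sub>1 @\<^sub>r \<tau>\<^sub>2 | \<tau>\<^sub>1 \<tau>\<^sub>2. \<tau>\<^sub>1 \<in> partial_perms n \<and> \<tau>\<^sub>2 \<in> partial_perms n \<and>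
     vec_space.rank (n + n) (\<tau>\<^sub>1 @\<^sub>r \<tau>\<^sub>2) = n}"

definition Im_span :: "nat \<Rightarrow> complex mat \<Rightarrow> complex vec set" where
  "Im_span n \<omega> = LinearCombinations.module.span class_ring (module_vec TYPE(complex) (n + n))
     (set (cols \<omega>))"

definition perm_mat :: "nat \<Rightarrow> (nat \<Rightarrow> nat) \<Rightarrow> complex mat" where
  "perm_mat n p = mat n n (\<lambda>(i, j). if i = p j then 1 else 0)"

text \<open>The orbit relation of the right action of the symmetric group by column permutations:
  column \<open>j\<close> of \<open>\<omega> * perm_mat n p\<close> is column \<open>p j\<close> of \<open>\<omega>\<close>.\<close>

definition col_perm_rel :: "nat \<Rightarrow> (complex mat \<times> complex mat) set" where
  "col_perm_rel n = {(\<omega>, \<omega>'). \<omega> \<in> pp_pairs n \<and> \<omega>' \<in> pp_pairs n \<and>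
     (\<exists>p. p permutes {..<n} \<and> \<omega>' = \<omega> * perm_mat n p)}"

lemma GL_carrier: "carrier (GL m) =
    {g \<in> carrier_mat m m. \<exists>h\<in>carrier_mat m m. h * g = 1\<^sub>m m \<and> g * h = 1\<^sub>m m}"
  by (auto simp: GL_def units_of_def Units_def ring_mat_simps)

lemma GL_simps: "mult (GL m) = (*)" "one (GL m) = 1\<^sub>m m"
  by (auto simp: GL_def units_of_def ring_mat_simps)

lemma GL_group: "group (GL m)"
  unfolding GL_def by (rule monoid.units_group) (rule ring.is_monoid[OF ring_mat])

lemma std_sub_carrier: "std_sub n \<subseteq> carrier_vec (n + n)"
  by (auto simp: std_sub_def)

lemma act_mult:
  assumes "g \<in> carrier_mat m m" "h \<in> carrier_mat m m" "W \<subseteq> carrier_vec m"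
  shows "act (g * h) W = act g (act h W)"
  unfolding act_def image_image
  by (rule image_cong) (use assms in \<open>auto intro!: assoc_mult_mat_vec\<close>)

lemma act_one: "W \<subseteq> carrier_vec m \<Longrightarrow> act (1\<^sub>m m) W = W"
  unfolding act_def by force

lemma coset_of_act_std_sub:
  assumes g: "g \<in> carrier (GL (n + n))"
  shows "coset_of n (act g (std_sub n)) = g <#\<^bsub>GL (n + n)\<^esub> P_S n"
proof -
  let ?m = "n + n" and ?E = "std_sub n"
  interpret group "GL ?m" by (rule GL_group)
  have E: "?E \<subseteq> carrier_vec ?m" by (rule std_sub_carrier)
  have sub: "x \<in> carrier (GL ?m) \<Longrightarrow> x \<in> carrier_mat ?m ?m" for x by (auto simp: GL_carrier)
  obtain h where h: "h \<in> carrier (GL ?m)" "h * g = 1\<^sub>m ?m" "g * h = 1\<^sub>m ?m"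
    using g inv_closed[OF g] l_inv[OF g] r_inv[OF g] unfolding GL_simps by blast
  show ?thesis
  proof (rule Set.set_eqI, rule iffI)
    fix x assume "x \<in> coset_of n (act g ?E)"
    hence x: "x \<in> carrier (GL ?m)" "act x ?E = act g ?E" by (auto simp: coset_of_def)
    have hx: "h * x \<in> carrier (GL ?m)" using m_closed[OF h(1) x(1)] by (simp add: GL_simps)
    have "act (h * x) ?E = act h (act g ?E)"
      using act_mult[OF sub[OF h(1)] sub[OF x(1)] E] x(2) by simp
    also have "\<dots> = ?E"
      using act_mult[OF sub[OF h(1)] sub[OF g] E] h(2) act_one[OF E] by simp
    finally have "h * x \<in> P_S n" using hx by (simp add: P_S_def stabilizer_def)
    moreover have "x = g * (h * x)"
      using assoc_mult_mat[OF sub[OF g] sub[OF h(1)] sub[OF x(1)]] h(3) sub[OF x(1)] by simp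
    ultimately show "x \<in> g <#\<^bsub>GL ?m\<^esub> P_S n" by (auto simp: l_coset_def GL_simps)
  next
    fix x assume "x \<in> g <#\<^bsub>GL ?m\<^esub> P_S n"
    then obtain p where p: "p \<in> carrier (GL ?m)" "act p ?E = ?E" "x = g * p"
      by (auto simp: l_coset_def GL_simps P_S_def stabilizer_def)
    show "x \<in> coset_of n (act g ?E)"
      using m_closed[OF g p(1)] act_mult[OF sub[OF g] sub[OF p(1)] E] p
      by (simp add: coset_of_def GL_simps)
  qed
qed

end

theory Submission
  imports Defs
begin

text \<open>
  A partial permutation has at most one nonzero entry in each row and column, so a matrix \<open>\<omega>\<close> in
  \<open>pp_pairs n\<close> is a list of \<open>n\<close> pairwise disjoint, nonempty sets of row indices, the supports of its
  columns. Each of them contains at most one index \<open>< n\<close> and at most one index \<open>\<ge> n\<close>; such a set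
  is called a block. A column permutation reorders the list, so the class of \<open>\<omega>\<close> is the
  \<^emph>\<open>set\<close> of its blocks, and \<open>Im \<omega>\<close> consists of the vectors that are constant on every block and vanish
  outside the blocks: it depends on that set alone. The first two claims thus say that the
  \<open>B\<^sub>K\<close>-orbits of subspaces of dimension \<open>n\<close> are classified by families of \<open>n\<close> disjoint blocks.

  Let \<open>B\<^sub>K\<close> be described by the partial order on the row indices that compares two indices of the same
  half as numbers and leaves indices of different halves unrelated: \<open>B\<^sub>K\<close> consists of the matrices
  with nonzero diagonal whose entry at \<open>(r, s)\<close> vanishes unless \<open>r\<close> lies below \<open>s\<close>.

  \<^emph>\<open>Existence\<close> (\<open>BK_normal_form\<close>). Let \<open>W\<close> lie in the span of the first \<open>s + 1\<close> unit vectors. By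
  induction the vectors of \<open>W\<close> whose coordinate \<open>s\<close> vanishes can be moved by \<open>B\<^sub>K\<close> to the space
  of a block family. If \<open>W\<close> is larger, then it is generated over them by one
  vector \<open>w\<close> with coordinate \<open>1\<close> at \<open>s\<close>. Subtracting a vector of the space of the family makes \<open>w\<close>
  vanish at the indices of the other half that are already used. If \<open>w\<close> now has a last nonzero
  coordinate \<open>j\<close> in the other half, then \<open>D = {s, j}\<close> is a new block, otherwise \<open>D = {s}\<close> is. One element
  of \<open>B\<^sub>K\<close> takes the indicator vector of \<open>D\<close> to \<open>w\<close> and fixes all vectors that vanish on \<open>D\<close>
  (\<open>BK_sweep\<close>), in particular the space of the old family.

  \<^emph>\<open>Uniqueness\<close> (\<open>blocks_of_act\<close>, \<open>blocks_of_block_space\<close>). The family is read off from \<open>W\<close> by a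
  recipe that only uses the order: a block \<open>D\<close> occurs if and only if some vector of \<open>W\<close> supported
  below \<open>D\<close> is not the sum of two such vectors of \<open>W\<close> each of which has a zero on \<open>D\<close>. An element of
  \<open>B\<^sub>K\<close> preserves being supported below \<open>D\<close>, and it scales the coordinates at \<open>D\<close> of such a vector by
  nonzero factors because each of them is the topmost one in its half.

  The last claim is the formal fact that \<open>(k B\<^sub>K, D) \<mapsto> k\<^sup>-\<^sup>1 D\<close> identifies the \<open>K\<close>-orbits on
  \<open>K/B\<^sub>K \<times> Y\<close> with the \<open>B\<^sub>K\<close>-orbits on \<open>Y\<close>. It needs that \<open>GL\<^sub>2\<^sub>n\<close> acts
  transitively on the Grassmannian, so that \<open>G/P\<^sub>S\<close> is all of it. By the normal form, only
  \<open>Im \<omega>\<close> has to be reached from the standard subspace, and for this \<open>\<omega>\<close> is completed to an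
  invertible matrix by unit vectors.
\<close>

section \<open>Matrices acting on coordinates\<close>

lemma index_mult_mat_vec_sum:
  fixes g :: "'a :: semiring_0 mat"
  assumes "g \<in> carrier_mat m k" "v \<in> carrier_vec k" "r < m"
  shows "(g *\<^sub>v v) $ r = (\<Sum>i<k. g $$ (r, i) * v $ i)"
  using assms by (auto simp: scalar_prod_def lessThan_atLeast0 intro!: sum.cong)

lemma GL_carrier_det: "carrier (GL m) = {g \<in> carrier_mat m m. det g \<noteq> 0}"
proof (intro Set.set_eqI iffI; clarsimp)
  fix g assume g: "g \<in> carrier (GL m)"
  then obtain h where "g \<in> carrier_mat m m" "h \<in> carrier_mat m m" "h * g = 1\<^sub>m m"
    by (auto simp: GL_carrier)
  thus "g \<in> carrier_mat m m \<and> det g \<noteq> 0"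
    by (metis det_mult det_one mult_zero_right zero_neq_one)
next
  fix g :: "complex mat" assume "g \<in> carrier_mat m m" "det g \<noteq> 0"
  thus "g \<in> carrier (GL m)"
    using det_non_zero_imp_unit[of g m "()"] by (simp add: GL_def units_of_def)
qed

lemma GL_dim: "g \<in> carrier (GL m) \<Longrightarrow> g \<in> carrier_mat m m"
  by (simp add: GL_carrier)

lemma GL_inv:
  assumes "g \<in> carrier (GL m)"
  shows "inv\<^bsub>GL m\<^esub> g \<in> carrier (GL m)" "inv\<^bsub>GL m\<^esub> g * g = 1\<^sub>m m" "g * inv\<^bsub>GL m\<^esub> g = 1\<^sub>m m"
  using group.inv_closed[OF GL_group assms] group.l_inv[OF GL_group assms]
    group.r_inv[OF GL_group assms] by (simp_all add: GL_simps)

lemma GL_mult: "g \<in> carrier (GL m) \<Longrightarrow> h \<in> carrier (GL m) \<Longrightarrow> g * h \<in> carrier (GL m)"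
  using monoid.m_closed[OF group.is_monoid[OF GL_group]] by (metis GL_simps(1))

lemma act_carrier:
  assumes "g \<in> carrier_mat m m" "W \<subseteq> carrier_vec m"
  shows "act g W \<subseteq> carrier_vec m"
  using assms by (auto simp: act_def)

section \<open>The Borel subgroup of K\<close>

text \<open>The equation \<open>h * g = 1\<close> determines the entries of a row of \<open>h\<close> left of the diagonal one after the
  other, from left to right: by triangularity of \<open>g\<close> the entry of \<open>h * g\<close> at \<open>(i, j)\<close> involves only
  the entries of \<open>h\<close> up to column \<open>j\<close>, and \<open>g $$ (j, j) \<noteq> 0\<close>.\<close>

lemma triangular_inverse:
  fixes g h :: "'a :: field mat"
  assumes g: "g \<in> carrier_mat m m" "upper_triangular g" and h: "h \<in> carrier_mat m m"
    and hg: "h * g = 1\<^sub>m m"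
  shows "upper_triangular h"
proof -
  have "det g \<noteq> 0" using g h hg by (metis det_mult det_one mult_zero_right zero_neq_one)
  hence diag: "g $$ (j, j) \<noteq> 0" if "j < m" for j
    using upper_triangular_imp_det_eq_0_iff[OF g] g(1) that by (force simp: diag_mat_def)
  have "h $$ (i, j) = 0" if "i < m" "j < i" for i j
    using that(2)
  proof (induction j rule: less_induct)
    case (less j)
    have "0 = (h * g) $$ (i, j)" using hg that(1) less.prems by simp
    also have "\<dots> = (\<Sum>k<m. h $$ (i, k) * g $$ (k, j))"
      using g h that(1) less.prems by (simp add: scalar_prod_def lessThan_atLeast0)
    also have "\<dots> = (\<Sum>k\<in>{j}. h $$ (i, k) * g $$ (k, j))"
    proof (rule sum.mono_neutral_right)
      show "\<forall>k\<in>{..<m} - {j}. h $$ (i, k) * g $$ (k, j) = 0"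
      proof
        fix k assume k: "k \<in> {..<m} - {j}"
        show "h $$ (i, k) * g $$ (k, j) = 0"
        proof (cases "k < j")
          case True
          thus ?thesis using less by simp
        next
          case False
          thus ?thesis using k g upper_triangularD[OF g(2), of j k] by simp
        qed
      qed
    qed (use that less.prems in auto)
    finally show ?case using diag that less.prems by simp
  qed
  thus ?thesis using h by auto
qed

lemma subgroup_Borel: "subgroup (Borel m) (GL m)"
proof
  show "Borel m \<subseteq> carrier (GL m)" by (auto simp: Borel_def)
  show "\<one>\<^bsub>GL m\<^esub> \<in> Borel m"
    using group.is_monoid[OF GL_group, of m] monoid.one_closed[of "GL m"] by (simp add: Borel_def GL_simps)
next
  fix x y assume x: "x \<in> Borel m" and y: "y \<in> Borel m"
  have dims: "x \<in> carrier_mat m m" "y \<in> carrier_mat m m" using x y by (auto simp: Borel_def GL_dim)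
  have "x * y \<in> carrier (GL m)"
    using GL_mult x y by (simp add: Borel_def)
  moreover have "upper_triangular (x * y)"
  proof
    fix i j assume ij: "j < i" "i < dim_row (x * y)"
    have "x $$ (i, k) * y $$ (k, j) = 0" if "k < m" for k
      using x y ij that dims upper_triangularD[of x k i] upper_triangularD[of y j k]
      by (cases "k < i") (auto simp: Borel_def)
    thus "(x * y) $$ (i, j) = 0" using dims ij by (auto simp: scalar_prod_def intro!: sum.neutral)
  qed
  ultimately show "x \<otimes>\<^bsub>GL m\<^esub> y \<in> Borel m" by (simp add: Borel_def GL_simps)
next
  fix x assume "x \<in> Borel m"
  thus "inv\<^bsub>GL m\<^esub> x \<in> Borel m"
    using GL_inv[of x m] triangular_inverse[of x m "inv\<^bsub>GL m\<^esub> x"] by (auto simp: Borel_def GL_dim)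
qed

lemma block_diag_mult:
  assumes "a \<in> carrier_mat n n" "b \<in> carrier_mat n n" "c \<in> carrier_mat n n" "d \<in> carrier_mat n n"
  shows "block_diag n a b * block_diag n c d = block_diag n (a * c) (b * d)"
  unfolding block_diag_def
  by (subst mult_four_block_mat[of _ n n _ n _ n _ _ n _ n]) (use assms in auto)

lemma block_diag_carrier:
  "a \<in> carrier_mat n n \<Longrightarrow> b \<in> carrier_mat n n \<Longrightarrow> block_diag n a b \<in> carrier_mat (n + n) (n + n)"
  by (simp add: block_diag_def)

lemma block_diag_one: "block_diag n (1\<^sub>m n) (1\<^sub>m n) = 1\<^sub>m (n + n)"
  by (simp add: block_diag_def)

lemma block_diag_GL:
  assumes a: "a \<in> carrier (GL n)" and b: "b \<in> carrier (GL n)"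
  shows "block_diag n a b \<in> carrier (GL (n + n))"
    and "block_diag n (inv\<^bsub>GL n\<^esub> a) (inv\<^bsub>GL n\<^esub> b) * block_diag n a b = 1\<^sub>m (n + n)"
proof -
  let ?a' = "inv\<^bsub>GL n\<^esub> a" and ?b' = "inv\<^bsub>GL n\<^esub> b"
  note A = GL_inv[OF a] and B = GL_inv[OF b]
  note dims = GL_dim[OF a] GL_dim[OF b] GL_dim[OF A(1)] GL_dim[OF B(1)]
  show l: "block_diag n ?a' ?b' * block_diag n a b = 1\<^sub>m (n + n)"
    by (simp only: block_diag_mult[OF dims(3,4,1,2)] A(2) B(2) block_diag_one)
  have r: "block_diag n a b * block_diag n ?a' ?b' = 1\<^sub>m (n + n)"
    by (simp only: block_diag_mult[OF dims] A(3) B(3) block_diag_one)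
  show "block_diag n a b \<in> carrier (GL (n + n))"
    unfolding GL_carrier
    using l r block_diag_carrier[OF dims(1,2)] block_diag_carrier[OF dims(3,4)] by blast
qed

lemma subgroup_block_diag:
  assumes H: "subgroup H (GL n)"
  shows "subgroup {block_diag n a b | a b. a \<in> H \<and> b \<in> H} (GL (n + n))"
proof
  note HG = subgroup.mem_carrier[OF H]
  let ?D = "{block_diag n a b | a b. a \<in> H \<and> b \<in> H}"
  show "?D \<subseteq> carrier (GL (n + n))" using HG block_diag_GL(1) by blast
  show "\<one>\<^bsub>GL (n + n)\<^esub> \<in> ?D"
    using subgroup.one_closed[OF H] block_diag_one[of n, symmetric] unfolding GL_simps by blast
  show "x \<otimes>\<^bsub>GL (n + n)\<^esub> y \<in> ?D" if x: "x \<in> ?D" and y: "y \<in> ?D" for x y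
  proof -
    from x obtain a b where ab: "a \<in> H" "b \<in> H" "x = block_diag n a b" by blast
    from y obtain c d where cd: "c \<in> H" "d \<in> H" "y = block_diag n c d" by blast
    have "x \<otimes>\<^bsub>GL (n + n)\<^esub> y = block_diag n (a \<otimes>\<^bsub>GL n\<^esub> c) (b \<otimes>\<^bsub>GL n\<^esub> d)"
      unfolding GL_simps ab(3) cd(3)
      by (intro block_diag_mult GL_dim HG ab cd)
    thus ?thesis using subgroup.m_closed[OF H] ab cd by blast
  qed
  show "inv\<^bsub>GL (n + n)\<^esub> x \<in> ?D" if x: "x \<in> ?D" for x
  proof -
    from x obtain a b where ab: "a \<in> H" "b \<in> H" "x = block_diag n a b" by blast
    have "inv\<^bsub>GL (n + n)\<^esub> x = block_diag n (inv\<^bsub>GL n\<^esub> a) (inv\<^bsub>GL n\<^esub> b)"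
      by (rule group.inv_equality[OF GL_group])
        (simp_all add: GL_simps ab(3) block_diag_GL HG ab(1,2) GL_inv(1))
    thus ?thesis using ab subgroup.m_inv_closed[OF H] by blast
  qed
qed

lemma subgroup_K: "subgroup (K_set n) (GL (n + n))"
  unfolding K_set_def by (rule subgroup_block_diag[OF group.subgroup_self[OF GL_group]])

lemma subgroup_BK: "subgroup (BK_set n) (GL (n + n))"
  unfolding BK_set_def by (rule subgroup_block_diag[OF subgroup_Borel])

lemma BK_sub_K: "BK_set n \<subseteq> K_set n"
  by (auto simp: BK_set_def K_set_def Borel_def)

text \<open>The partial order on the \<open>2n\<close> row indices for which \<open>B\<^sub>K\<close> is the group of invertible triangular matrices:
  two chains of length \<open>n\<close>, one for each half.\<close>

definition below :: "nat \<Rightarrow> nat \<Rightarrow> nat \<Rightarrow> bool" where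
  "below n r s \<longleftrightarrow> r \<le> s \<and> (r < n \<longleftrightarrow> s < n)"

text \<open>Describing the group by its entries, with no block decomposition, lets the two halves be treated at once
  in all that follows.\<close>

lemma BK_set_iff:
  "g \<in> BK_set n \<longleftrightarrow> g \<in> carrier_mat (n + n) (n + n) \<and>
     (\<forall>r<n + n. \<forall>s<n + n. g $$ (r, s) \<noteq> 0 \<longrightarrow> below n r s) \<and> (\<forall>r<n + n. g $$ (r, r) \<noteq> 0)"
proof
  assume "g \<in> BK_set n"
  then obtain a b where ab: "a \<in> Borel n" "b \<in> Borel n" "g = block_diag n a b"
    by (auto simp: BK_set_def)
  have car: "x \<in> carrier_mat n n" "upper_triangular x" and det: "det x \<noteq> 0" if "x \<in> Borel n" for x
    using that by (auto simp: Borel_def GL_carrier_det)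
  have diag: "x $$ (j, j) \<noteq> 0" if "x \<in> Borel n" "j < n" for x j
    using upper_triangular_imp_det_eq_0_iff[OF car[OF that(1)]] det[OF that(1)] car(1)[OF that(1)] that
    by (force simp: diag_mat_def)
  have tri: "x $$ (i, j) \<noteq> 0 \<Longrightarrow> i \<le> j" if "x \<in> Borel n" "i < n" for x i j
    using upper_triangularD[OF car(2)[OF that(1)], of j i] car(1)[OF that(1)] that by force
  have entry: "g $$ (r, s) = (if r < n then if s < n then a $$ (r, s) else 0
      else if s < n then 0 else b $$ (r - n, s - n))" if "r < n + n" "s < n + n" for r s
    using that car(1)[OF ab(1)] car(1)[OF ab(2)] by (auto simp: ab(3) block_diag_def)
  have "below n r s" if "r < n + n" "s < n + n" "g $$ (r, s) \<noteq> 0" for r s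
    using that tri[OF ab(1), of r s] tri[OF ab(2), of "r - n" "s - n"]
    unfolding entry[OF that(1,2)] by (auto simp: below_def split: if_splits) arith
  moreover have "g $$ (r, r) \<noteq> 0" if "r < n + n" for r
    using that diag[OF ab(1), of r] diag[OF ab(2), of "r - n"] unfolding entry[OF that that] by auto
  moreover have "g \<in> carrier_mat (n + n) (n + n)"
    unfolding ab(3) by (intro block_diag_carrier car ab)
  ultimately show "g \<in> carrier_mat (n + n) (n + n) \<and>
     (\<forall>r<n + n. \<forall>s<n + n. g $$ (r, s) \<noteq> 0 \<longrightarrow> below n r s) \<and> (\<forall>r<n + n. g $$ (r, r) \<noteq> 0)"
    by blast
next
  assume asm: "g \<in> carrier_mat (n + n) (n + n) \<and>
     (\<forall>r<n + n. \<forall>s<n + n. g $$ (r, s) \<noteq> 0 \<longrightarrow> below n r s) \<and> (\<forall>r<n + n. g $$ (r, r) \<noteq> 0)"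
  have blk: "mat n n (\<lambda>(i, j). g $$ (i + k, j + k)) \<in> Borel n" (is "?x \<in> _") if "k = 0 \<or> k = n" for k
  proof -
    have x: "?x \<in> carrier_mat n n" by simp
    moreover have tri: "upper_triangular ?x"
    proof
      fix i j assume "j < i" "i < dim_row ?x"
      hence "\<not> below n (i + k) (j + k)" "i + k < n + n" "j + k < n + n" "i < n" "j < n"
        using that by (auto simp: below_def)
      thus "?x $$ (i, j) = 0" using asm by auto
    qed
    moreover have "det ?x \<noteq> 0"
      using upper_triangular_imp_det_eq_0_iff[OF x tri] asm that by (auto simp: diag_mat_def)
    ultimately show ?thesis by (simp add: Borel_def GL_carrier_det)
  qed
  have g: "g \<in> carrier_mat (n + n) (n + n)" using asm by blast
  have off: "g $$ (i, j) = 0" if "i < n + n" "j < n + n" "(i < n) \<noteq> (j < n)" for i j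
    using asm that unfolding below_def by blast
  have "g = block_diag n (mat n n (\<lambda>(i, j). g $$ (i + 0, j + 0))) (mat n n (\<lambda>(i, j). g $$ (i + n, j + n)))"
    (is "g = ?d")
  proof (rule eq_matI)
    fix i j assume "i < dim_row ?d" "j < dim_col ?d"
    hence "i < n + n" "j < n + n" by (simp_all add: block_diag_def)
    thus "g $$ (i, j) = ?d $$ (i, j)" using off[of i j] by (simp add: block_diag_def)
  qed (use g in \<open>simp_all add: block_diag_def\<close>)
  thus "g \<in> BK_set n" using blk[of 0] blk[of n] unfolding BK_set_def by blast
qed

section \<open>Linear subspaces\<close>

text \<open>The closure properties of a linear subspace, without the module structure in which \<open>Gr\<close> is
  phrased.\<close>

definition linear_set :: "nat \<Rightarrow> complex vec set \<Rightarrow> bool" where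
  "linear_set m W \<longleftrightarrow> W \<subseteq> carrier_vec m \<and> 0\<^sub>v m \<in> W \<and>
     (\<forall>v\<in>W. \<forall>w\<in>W. v + w \<in> W) \<and> (\<forall>c. \<forall>w\<in>W. c \<cdot>\<^sub>v w \<in> W)"

lemma linear_setD:
  assumes "linear_set m W"
  shows "W \<subseteq> carrier_vec m" "v \<in> W \<Longrightarrow> v \<in> carrier_vec m" "0\<^sub>v m \<in> W"
    "v \<in> W \<Longrightarrow> w \<in> W \<Longrightarrow> v + w \<in> W" "v \<in> W \<Longrightarrow> c \<cdot>\<^sub>v v \<in> W"
    "v \<in> W \<Longrightarrow> w \<in> W \<Longrightarrow> v - w \<in> W"
proof -
  show "v \<in> W \<Longrightarrow> w \<in> W \<Longrightarrow> v - w \<in> W"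
  proof -
    assume vw: "v \<in> W" "w \<in> W"
    hence "v - w = v + (-1) \<cdot>\<^sub>v w" using assms by (intro eq_vecI) (auto simp: linear_set_def)
    thus ?thesis using vw assms by (simp add: linear_set_def)
  qed
qed (use assms in \<open>auto simp: linear_set_def\<close>)

lemma act_inverse:
  assumes "g \<in> carrier (GL m)" "W \<subseteq> carrier_vec m"
  shows "act (inv\<^bsub>GL m\<^esub> g) (act g W) = W" "act g (act (inv\<^bsub>GL m\<^esub> g) W) = W"
  using act_mult[OF GL_dim GL_dim assms(2)] GL_inv[OF assms(1)] act_one[OF assms(2)] assms(1)
  by metis+

lemma linear_set_act:
  assumes g: "g \<in> carrier_mat m m" and W: "linear_set m W"
  shows "linear_set m (act g W)"
  unfolding linear_set_def
proof (intro conjI ballI allI)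
  note W = linear_setD[OF W]
  show "act g W \<subseteq> carrier_vec m" using act_carrier[OF g] W(1) .
  have "g *\<^sub>v 0\<^sub>v m = 0\<^sub>v m" using g by auto
  thus "0\<^sub>v m \<in> act g W" using W(3) unfolding act_def by (metis imageI)
  fix c v w assume "v \<in> act g W"
  then obtain v' where v: "v' \<in> W" "v = g *\<^sub>v v'" by (auto simp: act_def)
  show "c \<cdot>\<^sub>v v \<in> act g W"
    using mult_mat_vec[OF g W(2), of v' c] W(5)[of v' c] v unfolding act_def by (metis imageI)
  assume "w \<in> act g W"
  then obtain w' where w: "w' \<in> W" "w = g *\<^sub>v w'" by (auto simp: act_def)
  show "v + w \<in> act g W"
    using mult_add_distrib_mat_vec[OF g W(2) W(2), of v' w'] W(4)[of v' w'] v w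
    unfolding act_def by (metis imageI)
qed

section \<open>Blocks\<close>

text \<open>The possible supports of a nonzero column of two stacked partial permutations.\<close>

definition block :: "nat \<Rightarrow> nat set \<Rightarrow> bool" where
  "block n D \<longleftrightarrow> D \<noteq> {} \<and> D \<subseteq> {..<n + n} \<and> (\<forall>r\<in>D. \<forall>s\<in>D. (r < n \<longleftrightarrow> s < n) \<longrightarrow> r = s)"

definition block_family :: "nat \<Rightarrow> nat set set \<Rightarrow> bool" where
  "block_family n S \<longleftrightarrow> (\<forall>D\<in>S. block n D) \<and> disjoint S"

text \<open>The span of the indicator vectors of the sets in \<open>S\<close>, given by equations on the coordinates so
  that no linear combinations have to be handled.\<close>

definition block_space :: "nat \<Rightarrow> nat set set \<Rightarrow> complex vec set" where
  "block_space n S = {w \<in> carrier_vec (n + n).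
     (\<forall>D\<in>S. \<forall>r\<in>D. \<forall>s\<in>D. w $ r = w $ s) \<and> (\<forall>r<n + n. r \<notin> \<Union>S \<longrightarrow> w $ r = 0)}"

lemma block_spaceI:
  assumes "w \<in> carrier_vec (n + n)"
    and "\<And>D r s. D \<in> S \<Longrightarrow> r \<in> D \<Longrightarrow> s \<in> D \<Longrightarrow> w $ r = w $ s"
    and "\<And>r. r < n + n \<Longrightarrow> r \<notin> \<Union>S \<Longrightarrow> w $ r = 0"
  shows "w \<in> block_space n S"
  unfolding block_space_def using assms by blast

lemma block_spaceD:
  assumes "w \<in> block_space n S"
  shows "w \<in> carrier_vec (n + n)"
    and "D \<in> S \<Longrightarrow> r \<in> D \<Longrightarrow> s \<in> D \<Longrightarrow> w $ r = w $ s"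
    and "r < n + n \<Longrightarrow> r \<notin> \<Union>S \<Longrightarrow> w $ r = 0"
  using assms unfolding block_space_def by blast+

lemma block_family_unique:
  assumes "block_family n S" "D \<in> S" "D' \<in> S" "r \<in> D" "r \<in> D'"
  shows "D = D'"
  using assms by (auto simp: block_family_def disjoint_def)

lemma block_family_less:
  assumes "block_family n S" "D \<in> S" "r \<in> D"
  shows "r < n + n"
  using assms by (auto simp: block_family_def block_def)

lemma block_space_linear:
  assumes "block_family n S"
  shows "linear_set (n + n) (block_space n S)"
  unfolding linear_set_def
proof (intro conjI ballI allI)
  note less = block_family_less[OF assms]
  note bs = block_space_def
  show "block_space n S \<subseteq> carrier_vec (n + n)" by (auto simp: bs)
  show "0\<^sub>v (n + n) \<in> block_space n S" using less by (simp add: bs)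
  fix v w c assume v: "v \<in> block_space n S"
  have vc: "v \<in> carrier_vec (n + n)"
    and vD: "D \<in> S \<Longrightarrow> r \<in> D \<Longrightarrow> s \<in> D \<Longrightarrow> v $ r = v $ s"
    and v0: "r < n + n \<Longrightarrow> r \<notin> \<Union>S \<Longrightarrow> v $ r = 0" for D r s
    using v unfolding bs by blast+
  show "c \<cdot>\<^sub>v v \<in> block_space n S"
    unfolding bs
  proof (intro CollectI conjI ballI allI impI)
    fix D r s assume "D \<in> S" "r \<in> D" "s \<in> D"
    thus "(c \<cdot>\<^sub>v v) $ r = (c \<cdot>\<^sub>v v) $ s" using less[of D] vD[of D r s] vc by simp
  qed (use vc v0 in simp_all)
  assume w: "w \<in> block_space n S"
  have wc: "w \<in> carrier_vec (n + n)"
    and wD: "D \<in> S \<Longrightarrow> r \<in> D \<Longrightarrow> s \<in> D \<Longrightarrow> w $ r = w $ s"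
    and w0: "r < n + n \<Longrightarrow> r \<notin> \<Union>S \<Longrightarrow> w $ r = 0" for D r s
    using w unfolding bs by blast+
  show "v + w \<in> block_space n S"
    unfolding bs
  proof (intro CollectI conjI ballI allI impI)
    fix D r s assume "D \<in> S" "r \<in> D" "s \<in> D"
    thus "(v + w) $ r = (v + w) $ s" using less[of D] vD[of D r s] wD[of D r s] wc by simp
  qed (use vc wc v0 w0 in simp_all)
qed

lemma block_space_exists:
  assumes S: "block_family n S"
  obtains z where "z \<in> block_space n S" "\<And>D r. D \<in> S \<Longrightarrow> r \<in> D \<Longrightarrow> z $ r = f D"
proof -
  define z where "z = vec (n + n) (\<lambda>r. if r \<in> \<Union>S then f (THE D. D \<in> S \<and> r \<in> D) else 0)"
  have val: "z $ r = f D" if "D \<in> S" "r \<in> D" for D r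
  proof -
    have "(THE D. D \<in> S \<and> r \<in> D) = D"
      using that block_family_unique[OF S] by (intro the_equality) auto
    moreover have "r \<in> \<Union>S" using that by blast
    ultimately show ?thesis using block_family_less[OF S that] by (simp add: z_def)
  qed
  have "z \<in> block_space n S"
  proof (rule block_spaceI)
    show "z \<in> carrier_vec (n + n)" by (simp add: z_def)
    show "z $ r = z $ s" if "D \<in> S" "r \<in> D" "s \<in> D" for D r s
      using that val[of D] by simp
    show "z $ r = 0" if "r < n + n" "r \<notin> \<Union>S" for r
      using that by (simp add: z_def)
  qed
  thus thesis using that val by blast
qed

definition indic :: "nat \<Rightarrow> nat set \<Rightarrow> complex vec" where
  "indic n D = vec (n + n) (\<lambda>r. if r \<in> D then 1 else 0)"

section \<open>Normal form under the Borel subgroup\<close>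

text \<open>The matrix \<open>h\<close> is the identity with the column of each \<open>d \<in> D\<close> replaced by the part of \<open>w\<close> in the half
  of \<open>d\<close>. The condition on the support of \<open>w\<close> says that these columns fit the triangular shape of
  \<open>B\<^sub>K\<close>; they add up to \<open>w\<close>, and a vector that vanishes on \<open>D\<close> does not see them.\<close>

lemma BK_sweep:
  assumes D: "block n D" and w: "w \<in> carrier_vec (n + n)" "\<And>d. d \<in> D \<Longrightarrow> w $ d \<noteq> 0"
    and supp: "\<And>r. r < n + n \<Longrightarrow> w $ r \<noteq> 0 \<Longrightarrow> \<exists>d\<in>D. below n r d"
  shows "\<exists>h\<in>BK_set n. h *\<^sub>v indic n D = w \<and>
    (\<forall>u\<in>carrier_vec (n + n). (\<forall>d\<in>D. u $ d = 0) \<longrightarrow> h *\<^sub>v u = u)"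
proof -
  let ?m = "n + n"
  have uniq: "c = d" if "c \<in> D" "d \<in> D" "(c < n) = (d < n)" for c d
    using D that by (auto simp: block_def)
  have Dsub: "D \<subseteq> {..<?m}" using D by (simp add: block_def)
  define h where "h = mat ?m ?m (\<lambda>(r, c).
     if c \<in> D then (if (r < n) = (c < n) then w $ r else 0) else if r = c then 1 else 0)"
  have h: "h \<in> carrier_mat ?m ?m" by (simp add: h_def)
  have hBK: "h \<in> BK_set n"
    unfolding BK_set_iff
  proof (intro conjI allI impI h)
    fix r s assume rs: "r < ?m" "s < ?m" "h $$ (r, s) \<noteq> 0"
    show "below n r s"
    proof (cases "s \<in> D")
      case True
      \<comment> \<open>As \<open>D\<close> meets each half at most once, the index that bounds \<open>r\<close> must be \<open>s\<close>.\<close>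
      hence half: "(r < n) = (s < n)" and "w $ r \<noteq> 0" using rs by (auto simp: h_def split: if_splits)
      then obtain d where d: "d \<in> D" "below n r d" using supp rs by blast
      have "d = s" using uniq[OF d(1) True] d(2) half by (auto simp: below_def)
      thus ?thesis using d by simp
    next
      case False
      thus ?thesis using rs by (auto simp: h_def below_def split: if_splits)
    qed
  next
    fix r assume "r < ?m"
    thus "h $$ (r, r) \<noteq> 0" using w(2) by (auto simp: h_def)
  qed
  have hD: "h *\<^sub>v indic n D = w"
  proof (rule eq_vecI)
    fix r assume "r < dim_vec w"
    hence r: "r < ?m" using w by simp
    have "(h *\<^sub>v indic n D) $ r = (\<Sum>i<?m. h $$ (r, i) * indic n D $ i)"
      by (rule index_mult_mat_vec_sum[OF h]) (use r in \<open>auto simp: indic_def\<close>)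
    also have "\<dots> = (\<Sum>i\<in>D. if (r < n) = (i < n) then w $ r else 0)"
      using Dsub r by (intro sum.mono_neutral_cong_right) (auto simp: indic_def h_def)
    also have "\<dots> = w $ r"
    proof (cases "w $ r = 0")
      case True
      thus ?thesis by (auto intro: sum.neutral)
    next
      case False
      then obtain d where d: "d \<in> D" "below n r d" using supp r by blast
      have "(\<Sum>i\<in>D. if (r < n) = (i < n) then w $ r else 0)
          = (\<Sum>i\<in>{d}. if (r < n) = (i < n) then w $ r else 0)"
        using d uniq[of d] finite_subset[OF Dsub]
        by (intro sum.mono_neutral_right) (auto simp: below_def)
      thus ?thesis using d by (simp add: below_def)
    qed
    finally show "(h *\<^sub>v indic n D) $ r = w $ r" .
  qed (use w h in auto)
  have "h *\<^sub>v u = u" if u: "u \<in> carrier_vec ?m" "\<And>d. d \<in> D \<Longrightarrow> u $ d = 0" for u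
  proof (rule eq_vecI)
    fix r assume "r < dim_vec u"
    hence r: "r < ?m" using u by simp
    have "(h *\<^sub>v u) $ r = (\<Sum>i<?m. h $$ (r, i) * u $ i)"
      by (rule index_mult_mat_vec_sum[OF h u(1) r])
    also have "\<dots> = (\<Sum>i\<in>{r}. u $ i)"
      using r u(2) by (intro sum.mono_neutral_cong_right) (auto simp: h_def)
    finally show "(h *\<^sub>v u) $ r = u $ r" by simp
  qed (use u h in auto)
  thus ?thesis using hBK hD by blast
qed

lemma BK_GL: "g \<in> BK_set n \<Longrightarrow> g \<in> carrier (GL (n + n))"
  using subgroup.mem_carrier[OF subgroup_BK] .

lemma BK_inv: "g \<in> BK_set n \<Longrightarrow> inv\<^bsub>GL (n + n)\<^esub> g \<in> BK_set n"
  using subgroup.m_inv_closed[OF subgroup_BK] .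

lemma BK_mult: "g \<in> BK_set n \<Longrightarrow> h \<in> BK_set n \<Longrightarrow> g * h \<in> BK_set n"
  using subgroup.m_closed[OF subgroup_BK] by (simp add: GL_simps)

text \<open>Row \<open>s\<close> of \<open>g\<close> only involves coordinates above \<open>s\<close>, so a topmost coordinate is merely scaled.\<close>

lemma BK_top_coordinate:
  assumes g: "g \<in> BK_set n" and w: "w \<in> carrier_vec (n + n)" and s: "s < n + n"
    and top: "\<And>r. r < n + n \<Longrightarrow> below n s r \<Longrightarrow> r \<noteq> s \<Longrightarrow> w $ r = 0"
  shows "(g *\<^sub>v w) $ s = g $$ (s, s) * w $ s"
proof -
  have "(g *\<^sub>v w) $ s = (\<Sum>i<n + n. g $$ (s, i) * w $ i)"
    using index_mult_mat_vec_sum[OF _ w s] g by (simp add: BK_set_iff)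
  also have "\<dots> = (\<Sum>i\<in>{s}. g $$ (s, i) * w $ i)"
    using g s top by (intro sum.mono_neutral_right) (auto simp: BK_set_iff)
  finally show ?thesis by simp
qed

text \<open>The vectors supported on a lower set \<open>L\<close> of the order form a \<open>B\<^sub>K\<close>-stable subspace: these are the
  sums of a step of the flag in each half.\<close>

lemma BK_mono_support:
  assumes g: "g \<in> BK_set n" and w: "w \<in> carrier_vec (n + n)"
    and L: "\<And>r s. r < n + n \<Longrightarrow> s < n + n \<Longrightarrow> below n r s \<Longrightarrow> s \<in> L \<Longrightarrow> r \<in> L"
    and supp: "\<And>r. r < n + n \<Longrightarrow> r \<notin> L \<Longrightarrow> w $ r = 0"
    and r: "r < n + n" "r \<notin> L"
  shows "(g *\<^sub>v w) $ r = 0"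
proof -
  have "(g *\<^sub>v w) $ r = (\<Sum>i<n + n. g $$ (r, i) * w $ i)"
    using index_mult_mat_vec_sum[OF _ w r(1)] g by (simp add: BK_set_iff)
  also have "\<dots> = 0"
  proof (intro sum.neutral ballI)
    fix i assume i: "i \<in> {..<n + n}"
    show "g $$ (r, i) * w $ i = 0"
      using g i r L[of r i] supp[of i] by (cases "i \<in> L") (auto simp: BK_set_iff)
  qed
  finally show ?thesis .
qed

text \<open>Induction on the number \<open>s\<close> of coordinates that \<open>W\<close> uses. The step is the same
  for both halves: if \<open>s\<close> lies in the first one, then the vectors of \<open>W\<close> vanish on the other half, and the
  new block is \<open>{s}\<close>.\<close>

lemma BK_normal_form:
  assumes "s \<le> n + n" "linear_set (n + n) W" "\<And>w r. w \<in> W \<Longrightarrow> s \<le> r \<Longrightarrow> r < n + n \<Longrightarrow> w $ r = 0"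
  shows "\<exists>g\<in>BK_set n. \<exists>S. block_family n S \<and> \<Union>S \<subseteq> {..<s} \<and> W = act g (block_space n S)"
  using assms
proof (induction s arbitrary: W)
  case 0
  have "W = {0\<^sub>v (n + n)}"
    using linear_setD[OF 0(2)] 0(3) by (auto intro!: eq_vecI)
  also have "\<dots> = block_space n {}" by (auto simp: block_space_def intro!: eq_vecI)
  finally have W: "W = block_space n {}" .
  have "1\<^sub>m (n + n) \<in> BK_set n"
    using subgroup.one_closed[OF subgroup_BK] by (simp add: GL_simps)
  moreover have "W = act (1\<^sub>m (n + n)) (block_space n {})"
    using act_one[of W "n + n"] linear_setD(1)[OF 0(2)] W by simp
  ultimately show ?case by (intro bexI[of _ "1\<^sub>m (n + n)"] exI[of _ "{}"]) (auto simp: block_family_def)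
next
  case (Suc s)
  let ?m = "n + n"
  have s: "s < ?m" using Suc.prems by simp
  note W = linear_setD[OF Suc.prems(2)]
  define W' where "W' = {w \<in> W. w $ s = 0}"
  have "linear_set ?m W'"
    unfolding linear_set_def
  proof (intro conjI ballI allI)
    show "W' \<subseteq> carrier_vec ?m" using W by (auto simp: W'_def)
    show "0\<^sub>v ?m \<in> W'" using W s by (auto simp: W'_def)
    fix v w c assume v: "v \<in> W'"
    have vc: "v \<in> carrier_vec ?m" and vW: "v \<in> W" "v $ s = 0" using v W by (auto simp: W'_def)
    have "(c \<cdot>\<^sub>v v) $ s = 0" using vc vW s by simp
    thus "c \<cdot>\<^sub>v v \<in> W'" using W(5)[OF vW(1)] by (simp add: W'_def)
    assume w: "w \<in> W'"
    have wc: "w \<in> carrier_vec ?m" and wW: "w \<in> W" "w $ s = 0" using w W by (auto simp: W'_def)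
    have "(v + w) $ s = 0" using wc vW wW s by simp
    thus "v + w \<in> W'" using W(4)[OF vW(1) wW(1)] by (simp add: W'_def)
  qed
  moreover have "w $ r = 0" if "w \<in> W'" "s \<le> r" "r < ?m" for w r
    using that Suc.prems(3)[of w r] by (cases "r = s") (auto simp: W'_def)
  ultimately obtain g S where g: "g \<in> BK_set n" and S: "block_family n S" "\<Union>S \<subseteq> {..<s}"
    and W'g: "W' = act g (block_space n S)"
    using Suc.IH[of W'] s by auto
  note gG = BK_GL[OF g] and gi = BK_inv[OF g]
  let ?gi = "inv\<^bsub>GL ?m\<^esub> g"
  \<comment> \<open>\<open>W1\<close> is \<open>W\<close> after the change of coordinates that brings \<open>W'\<close> into normal form.\<close>
  define W1 where "W1 = act ?gi W"
  have W1lin: "linear_set ?m W1"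
    unfolding W1_def by (rule linear_set_act[OF GL_dim[OF BK_GL[OF gi]] Suc.prems(2)])
  note W1 = linear_setD[OF W1lin]
  have WW1: "W = act g W1" unfolding W1_def using act_inverse(2)[OF gG W(1)] by simp
  have top: "w $ r = 0" if "w \<in> W1" "s < r" "r < ?m" for w r
  proof -
    from that(1) obtain x where x: "x \<in> W" "w = ?gi *\<^sub>v x" by (auto simp: W1_def act_def)
    show ?thesis
      unfolding x(2)
      by (rule BK_mono_support[OF gi W(2)[OF x(1)], where L = "{..s}"])
        (use that Suc.prems(3)[OF x(1)] in \<open>auto simp: below_def\<close>)
  qed
  have W1': "u \<in> block_space n S \<longleftrightarrow> u \<in> W1 \<and> u $ s = 0" for u
  proof
    have bs: "block_space n S = act ?gi W'"
      unfolding W'g using act_inverse(1)[OF gG] linear_setD(1)[OF block_space_linear[OF S(1)]] by simp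
    assume u: "u \<in> block_space n S"
    have "u \<in> W1" using u unfolding bs W1_def W'_def act_def by auto
    moreover have "u $ s = 0" using block_spaceD(3)[OF u s] S(2) by blast
    ultimately show "u \<in> W1 \<and> u $ s = 0" ..
  next
    assume u: "u \<in> W1 \<and> u $ s = 0"
    have "(g *\<^sub>v u) $ s = 0"
      using BK_top_coordinate[OF g W1(2), of u s] u s top[of u] by (auto simp: below_def)
    moreover have "g *\<^sub>v u \<in> W" using u unfolding WW1 act_def by auto
    ultimately have "g *\<^sub>v u \<in> act g (block_space n S)" using W'g unfolding W'_def by auto
    then obtain u' where u': "u' \<in> block_space n S" "g *\<^sub>v u = g *\<^sub>v u'" by (auto simp: act_def)
    have "u' \<in> carrier_vec ?m" "u \<in> carrier_vec ?m"
      using block_spaceD(1)[OF u'(1)] u W1(2) by blast+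
    hence "u = u'" using u'(2) GL_inv[OF gG] GL_dim[OF gG] GL_dim[OF GL_inv(1)[OF gG]]
      by (metis assoc_mult_mat_vec one_mult_mat_vec)
    thus "u \<in> block_space n S" using u' by simp
  qed
  show ?case
  proof (cases "\<forall>w\<in>W1. w $ s = 0")
    case True
    hence "W1 = block_space n S" using W1' by blast
    hence "W = act g (block_space n S)" using WW1 by simp
    moreover have "\<Union>S \<subseteq> {..<Suc s}" using S(2) by fastforce
    ultimately show ?thesis using g S(1) by blast
  next
    case False
    then obtain w0 where w0: "w0 \<in> W1" "w0 $ s \<noteq> 0" by auto
    \<comment> \<open>Subtract from \<open>w0\<close> the vector \<open>z\<close> of the block space that agrees with it at the other-half
      index of every block. On a block without such an index the choice is arbitrary and so is the value of
      \<open>z\<close>: this block lies below \<open>s\<close> in the half of \<open>s\<close>, where nothing is asked of \<open>w\<close>.\<close>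
    define other where "other d \<longleftrightarrow> d < ?m \<and> (d < n) \<noteq> (s < n)" for d
    obtain z where z: "z \<in> block_space n S"
      "\<And>D r. D \<in> S \<Longrightarrow> r \<in> D \<Longrightarrow> z $ r = w0 $ (SOME d. d \<in> D \<and> other d)"
      by (rule block_space_exists[OF S(1), of "\<lambda>D. w0 $ (SOME d. d \<in> D \<and> other d)"]) (rule that)
    have zW: "z \<in> W1" "z $ s = 0" using z(1) W1' by auto
    define w where "w = inverse (w0 $ s) \<cdot>\<^sub>v (w0 - z)"
    have wW: "w \<in> W1" unfolding w_def using W1(5,6) w0 zW by blast
    have wc: "w \<in> carrier_vec ?m" using W1(2) wW .
    have w_eq: "w $ r = inverse (w0 $ s) * (w0 $ r - z $ r)" if "r < ?m" for r
      using that W1(2)[OF zW(1)] by (simp add: w_def)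
    have ws: "w $ s = 1" using w_eq[OF s] zW w0 by simp
    have w_other: "w $ d = 0" if "other d" "d \<in> \<Union>S" for d
    proof -
      from that(2) obtain D where D: "D \<in> S" "d \<in> D" by auto
      have "(SOME d. d \<in> D \<and> other d) = d"
        using D that(1) S(1) by (intro some_equality) (auto simp: block_family_def block_def other_def)
      thus ?thesis using w_eq[of d] z(2)[OF D] that(1) by (simp add: other_def)
    qed
    \<comment> \<open>The new block: \<open>s\<close>, and the topmost index of the other half at which \<open>w\<close> does not vanish.\<close>
    obtain D where D: "block n D" "s \<in> D" "D \<subseteq> {..s}" "D \<inter> \<Union>S = {}" "\<And>d. d \<in> D \<Longrightarrow> w $ d \<noteq> 0"
      "\<And>r. r < ?m \<Longrightarrow> w $ r \<noteq> 0 \<Longrightarrow> \<exists>d\<in>D. below n r d"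
    proof (cases "\<exists>d. other d \<and> w $ d \<noteq> 0")
      case False
      have below_s: "r < ?m \<Longrightarrow> w $ r \<noteq> 0 \<Longrightarrow> below n r s" for r
        using False top[OF wW, of r] by (auto simp: below_def other_def not_le[symmetric])
      show ?thesis
        by (rule that[of "{s}"]) (use s ws S below_s in \<open>auto simp: block_def\<close>)
    next
      case True
      have fin: "finite {d. other d \<and> w $ d \<noteq> 0}"
        by (rule finite_subset[of _ "{..<?m}"]) (auto simp: other_def)
      obtain j where j: "other j" "w $ j \<noteq> 0" and jmax: "\<And>d. other d \<Longrightarrow> w $ d \<noteq> 0 \<Longrightarrow> d \<le> j"
        using Max_in[OF fin] Max_ge[OF fin] True by blast
      have jm: "j < ?m" "(j < n) \<noteq> (s < n)" using j(1) by (simp_all add: other_def)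
      have js: "j \<le> s" using top[OF wW, of j] j(2) jm(1) by (metis not_le)
      have jS: "j \<notin> \<Union>S" using w_other[OF j(1)] j(2) by blast
      have below_s: "\<exists>d\<in>{s, j}. below n r d" if "r < ?m" "w $ r \<noteq> 0" for r
      proof (cases "other r")
        case True
        thus ?thesis using jmax[of r] jm that by (simp add: below_def other_def)
      next
        case False
        thus ?thesis using top[OF wW, of r] that by (auto simp: below_def other_def not_le[symmetric])
      qed
      have sS: "s \<notin> \<Union>S" using S(2) by auto
      show ?thesis
        by (rule that[of "{s, j}"]) (use s ws jS sS j(2) js jm below_s in \<open>auto simp: block_def\<close>)
    qed
    obtain h where h: "h \<in> BK_set n" "h *\<^sub>v indic n D = w"
      "\<And>u. u \<in> carrier_vec ?m \<Longrightarrow> (\<And>d. d \<in> D \<Longrightarrow> u $ d = 0) \<Longrightarrow> h *\<^sub>v u = u"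
      using BK_sweep[OF D(1) wc D(5,6)] by blast
    let ?S = "insert D S"
    have S': "block_family n ?S"
      using S(1) D(1,4) by (auto simp: block_family_def disjoint_def)
    have Dm: "D \<subseteq> {..<?m}" using D(1) by (simp add: block_def)
    \<comment> \<open>A vector of the new block space is \<open>c\<close> times the indicator of \<open>D\<close> plus a vector \<open>u\<close> of the old
      one. As \<open>u\<close> vanishes on \<open>D\<close>, it is fixed by \<open>h\<close>.\<close>
    have split: "h *\<^sub>v (c \<cdot>\<^sub>v indic n D + u) = c \<cdot>\<^sub>v w + u" if "u \<in> block_space n S" for c u
    proof -
      have u: "u \<in> carrier_vec ?m" using block_spaceD(1)[OF that] .
      have hu: "h *\<^sub>v u = u" using h(3)[OF u] block_spaceD(3)[OF that] D(4) Dm by blast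
      have ind: "indic n D \<in> carrier_vec ?m" by (simp add: indic_def)
      have hc: "h \<in> carrier_mat ?m ?m" using h(1) by (simp add: BK_set_iff)
      show ?thesis
        using mult_add_distrib_mat_vec[OF hc smult_carrier_vec[THEN iffD2, OF ind] u]
          mult_mat_vec[OF hc ind] h(2) hu by simp
    qed
    have mem: "e \<in> block_space n ?S \<longleftrightarrow> (\<exists>c. \<exists>u\<in>block_space n S. e = c \<cdot>\<^sub>v indic n D + u)" for e
    proof
      assume e: "e \<in> block_space n ?S"
      let ?u = "e - e $ s \<cdot>\<^sub>v indic n D"
      have "?u \<in> block_space n S"
      proof (rule block_spaceI)
        show "?u \<in> carrier_vec ?m" using block_spaceD(1)[OF e] by (simp add: indic_def)
        show "?u $ r = ?u $ q" if "A \<in> S" "r \<in> A" "q \<in> A" for A r q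
        proof -
          have "r \<notin> D" "q \<notin> D" using that D(4) by blast+
          moreover have "e $ r = e $ q" using block_spaceD(2)[OF e _ that(2,3)] that(1) by blast
          moreover have "r < ?m" "q < ?m" using that block_family_less[OF S(1)] by blast+
          ultimately show ?thesis by (simp add: indic_def)
        qed
        show "?u $ r = 0" if "r < ?m" "r \<notin> \<Union>S" for r
        proof (cases "r \<in> D")
          case True
          hence "e $ r = e $ s" using block_spaceD(2)[OF e _ _ D(2)] by blast
          thus ?thesis using that True by (simp add: indic_def)
        next
          case False
          thus ?thesis using that block_spaceD(3)[OF e, of r] by (simp add: indic_def)
        qed
      qed
      moreover have "e = e $ s \<cdot>\<^sub>v indic n D + ?u"
        using block_spaceD(1)[OF e] by (intro eq_vecI) (auto simp: indic_def)
      ultimately show "\<exists>c. \<exists>u\<in>block_space n S. e = c \<cdot>\<^sub>v indic n D + u" by blast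
    next
      assume "\<exists>c. \<exists>u\<in>block_space n S. e = c \<cdot>\<^sub>v indic n D + u"
      then obtain c u where u: "u \<in> block_space n S" and e: "e = c \<cdot>\<^sub>v indic n D + u" by blast
      have uc: "u \<in> carrier_vec ?m" and eq: "\<And>r. r < ?m \<Longrightarrow> e $ r = (if r \<in> D then c else 0) + u $ r"
        using block_spaceD(1)[OF u] by (auto simp: e indic_def)
      have out: "u $ r = 0" if "r \<in> D" for r using block_spaceD(3)[OF u, of r] that Dm D(4) by blast
      show "e \<in> block_space n ?S"
      proof (rule block_spaceI)
        show "e \<in> carrier_vec ?m" using uc e by (simp add: indic_def)
        show "e $ r = e $ q" if "A \<in> ?S" "r \<in> A" "q \<in> A" for A r q
        proof (cases "A = D")
          case True
          hence "r \<in> D" "q \<in> D" "r < ?m" "q < ?m" using that Dm by auto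
          thus ?thesis by (simp add: eq out)
        next
          case False
          hence A: "A \<in> S" using that by simp
          hence "r \<notin> D" "q \<notin> D" using that D(4) by blast+
          moreover have "u $ r = u $ q" using block_spaceD(2)[OF u A] that by blast
          moreover have "r < ?m" "q < ?m" using that A block_family_less[OF S(1)] by blast+
          ultimately show ?thesis by (simp add: eq)
        qed
        show "e $ r = 0" if "r < ?m" "r \<notin> \<Union>?S" for r
          using that block_spaceD(3)[OF u, of r] by (simp add: eq)
      qed
    qed
    have W1h: "W1 = act h (block_space n ?S)"
    proof (intro Set.set_eqI iffI)
      fix x assume x: "x \<in> W1"
      let ?u = "x - x $ s \<cdot>\<^sub>v w"
      have "?u \<in> W1" using x wW W1(5,6) by blast
      moreover have "?u $ s = 0" using ws wc s by simp
      ultimately have u: "?u \<in> block_space n S" using W1' by blast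
      have "x = x $ s \<cdot>\<^sub>v w + ?u" using W1(2)[OF x] wc by (intro eq_vecI) auto
      also have "\<dots> = h *\<^sub>v (x $ s \<cdot>\<^sub>v indic n D + ?u)" using split[OF u] by simp
      finally show "x \<in> act h (block_space n ?S)" using mem u unfolding act_def by blast
    next
      fix x assume "x \<in> act h (block_space n ?S)"
      then obtain e where e: "e \<in> block_space n ?S" "x = h *\<^sub>v e" unfolding act_def by blast
      from e(1) obtain c u where u: "u \<in> block_space n S" and ecu: "e = c \<cdot>\<^sub>v indic n D + u"
        unfolding mem by blast
      have x: "x = h *\<^sub>v (c \<cdot>\<^sub>v indic n D + u)" using e(2) ecu by simp
      show "x \<in> W1" unfolding x split[OF u] using W1(4,5) wW W1' u by blast
    qed
    have "W = act (g * h) (block_space n ?S)"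
      unfolding WW1 W1h
      by (rule act_mult[symmetric])
        (use GL_dim[OF gG] GL_dim[OF BK_GL[OF h(1)]] block_spaceD(1) in blast)+
    moreover have "\<Union>?S \<subseteq> {..<Suc s}" using S(2) D(3) by fastforce
    ultimately show ?thesis using BK_mult[OF g h(1)] S' by blast
  qed
qed

section \<open>The blocks of a subspace are invariants\<close>

text \<open>In the half of \<open>d \<in> D\<close> the coordinates vanish above \<open>d\<close>; in a half that \<open>D\<close> does not meet they all
  vanish.\<close>

definition supported :: "nat \<Rightarrow> nat set \<Rightarrow> complex vec \<Rightarrow> bool" where
  "supported n D w \<longleftrightarrow> (\<forall>r<n + n. w $ r \<noteq> 0 \<longrightarrow> (\<exists>d\<in>D. below n r d))"

text \<open>With \<open>F(D)\<close> for the space of vectors supported below \<open>D\<close>, this says that \<open>W \<inter> F(D)\<close> is not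
  generated by its intersections with the smaller steps of the two flags, where one of the topmost
  coordinates is zero. Equivalently, a difference of the dimensions of these intersections, mixed if \<open>D\<close>
  has two elements, is nonzero. The form chosen here avoids counting dimensions.\<close>

definition blocks_of :: "nat \<Rightarrow> complex vec set \<Rightarrow> nat set set" where
  "blocks_of n W = {D. block n D \<and> (\<exists>w\<in>W. supported n D w \<and>
     \<not> (\<exists>w1\<in>W. \<exists>w2\<in>W. w = w1 + w2 \<and> supported n D w1 \<and> supported n D w2 \<and>
           (\<exists>d\<in>D. w1 $ d = 0) \<and> (\<exists>d\<in>D. w2 $ d = 0)))}"

text \<open>For \<open>D \<in> S\<close> the indicator vector of \<open>D\<close> is indecomposable: the vectors of the block space are
  constant on \<open>D\<close>, so one with a zero on \<open>D\<close> vanishes on all of \<open>D\<close>. Conversely let \<open>w\<close> be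
  supported below a block \<open>D \<notin> S\<close>, and \<open>d \<in> D\<close>. If \<open>w $ d \<noteq> 0\<close>, then \<open>d\<close> lies in some \<open>A \<in> S\<close>, and \<open>A\<close>
  misses some \<open>e \<in> D\<close>. The restriction of \<open>w\<close> to \<open>A\<close> then vanishes at \<open>e\<close>, and its complement
  vanishes at \<open>d\<close>.\<close>

lemma blocks_of_block_space:
  assumes S: "block_family n S"
  shows "blocks_of n (block_space n S) = S"
proof (intro Set.set_eqI iffI)
  let ?E = "block_space n S" and ?m = "n + n"
  note E = linear_setD[OF block_space_linear[OF S]]
  fix D assume D: "D \<in> S"
  hence blk: "block n D" using S by (simp add: block_family_def)
  obtain w where w: "w \<in> ?E" "\<And>A r. A \<in> S \<Longrightarrow> r \<in> A \<Longrightarrow> w $ r = (if A = D then 1 else 0)"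
    by (rule block_space_exists[OF S, of "\<lambda>A. if A = D then 1 else 0"]) (rule that)
  have "supported n D w"
    unfolding supported_def
  proof (intro allI impI)
    fix r assume r: "r < ?m" "w $ r \<noteq> 0"
    then obtain A where "A \<in> S" "r \<in> A" using block_spaceD(3)[OF w(1)] by blast
    hence "r \<in> D" using w(2) r by (auto split: if_splits)
    thus "\<exists>d\<in>D. below n r d" by (auto simp: below_def)
  qed
  moreover have False if ww: "w1 \<in> ?E" "w2 \<in> ?E" "w = w1 + w2"
    and z: "d1 \<in> D" "w1 $ d1 = 0" "d2 \<in> D" "w2 $ d2 = 0" for w1 w2 d1 d2
  proof -
    have "w1 $ d1 = 0" "w2 $ d1 = 0"
      using block_spaceD(2)[OF ww(2) D z(1,3)] z by simp_all
    moreover have "d1 < ?m" using block_family_less[OF S D z(1)] .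
    ultimately have "w $ d1 = 0" using ww E(2)[OF ww(2)] by simp
    thus False using w(2)[OF D z(1)] by simp
  qed
  ultimately show "D \<in> blocks_of n ?E" unfolding blocks_of_def using blk w(1) by blast
next
  let ?E = "block_space n S" and ?m = "n + n"
  note E = linear_setD[OF block_space_linear[OF S]]
  fix D assume D: "D \<in> blocks_of n ?E"
  hence blk: "block n D" by (simp add: blocks_of_def)
  from D obtain w where w: "w \<in> ?E" "supported n D w" and irr:
    "\<And>w1 w2 d1 d2. w1 \<in> ?E \<Longrightarrow> w2 \<in> ?E \<Longrightarrow> w = w1 + w2 \<Longrightarrow> supported n D w1 \<Longrightarrow> supported n D w2
      \<Longrightarrow> d1 \<in> D \<Longrightarrow> w1 $ d1 = 0 \<Longrightarrow> d2 \<in> D \<Longrightarrow> w2 $ d2 = 0 \<Longrightarrow> False"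
    unfolding blocks_of_def by blast
  show "D \<in> S"
  proof (rule ccontr)
    assume DS: "D \<notin> S"
    obtain d where d: "d \<in> D" using blk by (auto simp: block_def)
    hence dm: "d < ?m" using blk by (auto simp: block_def)
    show False
    proof (cases "w $ d = 0")
      case True
      show False
        by (rule irr[OF w(1) E(3) _ w(2) _ d True d])
          (use E(2)[OF w(1)] dm in \<open>auto simp: supported_def\<close>)
    next
      case False
      then obtain A where A: "A \<in> S" "d \<in> A" using block_spaceD(3)[OF w(1) dm] by blast
      have A_below: "\<exists>d\<in>D. below n r d" if "r \<in> A" for r
      proof -
        have "w $ r = w $ d" using block_spaceD(2)[OF w(1) A(1) that A(2)] .
        thus ?thesis using False w(2) block_family_less[OF S A(1) that] by (simp add: supported_def)
      qed
      \<comment> \<open>Elements of \<open>A\<close> lie below elements of \<open>D\<close>, in the same half; if \<open>D \<subseteq> A\<close>, they coincide with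
        them because \<open>A\<close> meets each half at most once, so \<open>A = D\<close>.\<close>
      have "\<not> D \<subseteq> A"
      proof
        assume sub: "D \<subseteq> A"
        have "r \<in> D" if r: "r \<in> A" for r
        proof -
          obtain e where e: "e \<in> D" "below n r e" using A_below[OF r] by blast
          have "r = e" using S A(1) r sub e by (auto simp: block_family_def block_def below_def)
          thus ?thesis using e by simp
        qed
        hence "A = D" using sub by blast
        thus False using A DS by simp
      qed
      then obtain e where e: "e \<in> D" "e \<notin> A" by blast
      hence em: "e < ?m" using blk by (auto simp: block_def)
      obtain w1 where w1: "w1 \<in> ?E" "\<And>B r. B \<in> S \<Longrightarrow> r \<in> B \<Longrightarrow> w1 $ r = (if B = A then w $ d else 0)"
        by (rule block_space_exists[OF S, of "\<lambda>B. if B = A then w $ d else 0"]) (rule that)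
      have w1A: "w1 $ r = w $ r" if "r \<in> A" for r
        using w1(2)[OF A(1) that] block_spaceD(2)[OF w(1) A(1) that A(2)] by simp
      have w1nA: "w1 $ r = 0" if "r < ?m" "r \<notin> A" for r
        using block_spaceD(3)[OF w1(1) that(1)] w1(2)[of _ r] that(2) by (cases "r \<in> \<Union>S") auto
      have c: "w \<in> carrier_vec ?m" "w1 \<in> carrier_vec ?m" using E(2) w(1) w1(1) by auto
      show False
      proof (rule irr[of w1 "w - w1", OF w1(1) E(6)[OF w(1) w1(1)] _ _ _ e(1) _ d])
        show "w = w1 + (w - w1)" using c by (intro eq_vecI) auto
        show "supported n D w1" using w1nA A_below unfolding supported_def by blast
        show "supported n D (w - w1)"
          unfolding supported_def
        proof (intro allI impI)
          fix r assume r: "r < ?m" "(w - w1) $ r \<noteq> 0"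
          hence "w $ r \<noteq> 0" using w1A[of r] w1nA[of r] c by (cases "r \<in> A") auto
          thus "\<exists>d\<in>D. below n r d" using w(2) r by (simp add: supported_def)
        qed
        show "w1 $ e = 0" using w1nA[OF em e(2)] .
        show "(w - w1) $ d = 0" using w1A[OF A(2)] c dm by simp
      qed
    qed
  qed
qed

lemma BK_supported:
  assumes g: "g \<in> BK_set n" and w: "w \<in> carrier_vec (n + n)" and D: "block n D"
    and supp: "supported n D w"
  shows "supported n D (g *\<^sub>v w)" and "d \<in> D \<Longrightarrow> (g *\<^sub>v w) $ d = 0 \<longleftrightarrow> w $ d = 0"
proof -
  have tr: "below n r s \<Longrightarrow> below n s q \<Longrightarrow> below n r q" for r s q by (auto simp: below_def)
  show "supported n D (g *\<^sub>v w)"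
    unfolding supported_def
  proof (intro allI impI, rule ccontr)
    fix r assume r: "r < n + n" "(g *\<^sub>v w) $ r \<noteq> 0" "\<not> (\<exists>d\<in>D. below n r d)"
    have "(g *\<^sub>v w) $ r = 0"
    proof (rule BK_mono_support[OF g w, where L = "{r. \<exists>d\<in>D. below n r d}"])
      show "q \<in> {r. \<exists>d\<in>D. below n r d}" if "below n q s" "s \<in> {r. \<exists>d\<in>D. below n r d}" for q s
        using that tr by blast
      show "w $ q = 0" if "q < n + n" "q \<notin> {r. \<exists>d\<in>D. below n r d}" for q
        using that supp unfolding supported_def by blast
    qed (use r in simp_all)
    thus False using r by simp
  qed
  assume d: "d \<in> D"
  hence dm: "d < n + n" using D by (auto simp: block_def)
  have "w $ r = 0" if r: "r < n + n" "below n d r" "r \<noteq> d" for r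
  proof (rule ccontr)
    assume "w $ r \<noteq> 0"
    then obtain e where e: "e \<in> D" "below n r e" using supp r by (auto simp: supported_def)
    have "e = d" using D d e tr[OF r(2) e(2)] by (auto simp: block_def below_def)
    thus False using r e by (auto simp: below_def)
  qed
  hence "(g *\<^sub>v w) $ d = g $$ (d, d) * w $ d" by (rule BK_top_coordinate[OF g w dm])
  thus "(g *\<^sub>v w) $ d = 0 \<longleftrightarrow> w $ d = 0" using g dm by (simp add: BK_set_iff)
qed

text \<open>A decomposition of \<open>g w\<close> in \<open>g W\<close> is pulled back to one of \<open>w\<close> by \<open>g\<^sup>-\<^sup>1\<close>, which preserves support
  below \<open>D\<close> and zeros on \<open>D\<close>. The opposite inclusion is the same statement for \<open>g\<^sup>-\<^sup>1\<close>.\<close>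

lemma blocks_of_act:
  assumes g: "g \<in> BK_set n" and W: "W \<subseteq> carrier_vec (n + n)"
  shows "blocks_of n (act g W) = blocks_of n W"
proof -
  have sub: "blocks_of n W \<subseteq> blocks_of n (act g W)" if g: "g \<in> BK_set n" and W: "W \<subseteq> carrier_vec (n + n)" for g W
  proof
    let ?m = "n + n"
    note gc = GL_dim[OF BK_GL[OF g]]
    fix D assume "D \<in> blocks_of n W"
    then obtain w where D: "block n D" and w: "w \<in> W" "supported n D w" and irr:
      "\<And>w1 w2 d1 d2. w1 \<in> W \<Longrightarrow> w2 \<in> W \<Longrightarrow> w = w1 + w2 \<Longrightarrow> supported n D w1 \<Longrightarrow> supported n D w2
        \<Longrightarrow> d1 \<in> D \<Longrightarrow> w1 $ d1 = 0 \<Longrightarrow> d2 \<in> D \<Longrightarrow> w2 $ d2 = 0 \<Longrightarrow> False"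
      unfolding blocks_of_def by blast
    let ?gi = "inv\<^bsub>GL ?m\<^esub> g"
    have gi: "?gi \<in> BK_set n" using BK_inv[OF g] .
    have cancel: "?gi *\<^sub>v (g *\<^sub>v x) = x" if "x \<in> carrier_vec ?m" for x
      using that GL_inv(2)[OF BK_GL[OF g]] assoc_mult_mat_vec[OF GL_dim[OF BK_GL[OF gi]] gc that] by simp
    have False if x: "x1 \<in> W" "x2 \<in> W" "g *\<^sub>v w = g *\<^sub>v x1 + g *\<^sub>v x2"
      "supported n D (g *\<^sub>v x1)" "supported n D (g *\<^sub>v x2)"
      "d1 \<in> D" "(g *\<^sub>v x1) $ d1 = 0" "d2 \<in> D" "(g *\<^sub>v x2) $ d2 = 0" for x1 x2 d1 d2
    proof -
      have c: "w \<in> carrier_vec ?m" "x1 \<in> carrier_vec ?m" "x2 \<in> carrier_vec ?m" using W w x by auto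
      note gcx = mult_mat_vec_carrier[OF gc c(2)] mult_mat_vec_carrier[OF gc c(3)]
      have "g *\<^sub>v w = g *\<^sub>v (x1 + x2)" using x(3) mult_add_distrib_mat_vec[OF gc c(2,3)] by simp
      hence sum: "w = x1 + x2" using cancel c by (metis add_carrier_vec)
      have s1: "supported n D x1" using BK_supported(1)[OF gi gcx(1) D x(4)] cancel[OF c(2)] by simp
      have s2: "supported n D x2" using BK_supported(1)[OF gi gcx(2) D x(5)] cancel[OF c(3)] by simp
      have z1: "x1 $ d1 = 0" using BK_supported(2)[OF g c(2) D s1 x(6)] x(7) by simp
      have z2: "x2 $ d2 = 0" using BK_supported(2)[OF g c(3) D s2 x(8)] x(9) by simp
      show False by (rule irr[OF x(1,2) sum s1 s2 x(6) z1 x(8) z2])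
    qed
    moreover have "supported n D (g *\<^sub>v w)" using BK_supported(1)[OF g _ D w(2)] W w(1) by blast
    ultimately show "D \<in> blocks_of n (act g W)"
      using D w(1) unfolding blocks_of_def act_def by blast
  qed
  show ?thesis
    using sub[OF g W] sub[OF BK_inv[OF g] act_carrier[OF GL_dim[OF BK_GL[OF g]] W]]
      act_inverse(1)[OF BK_GL[OF g] W] by simp
qed

section \<open>Full column rank\<close>

lemma mult_mat_unit_vec:
  fixes A :: "'a :: semiring_1 mat"
  assumes "A \<in> carrier_mat m k" "j < k"
  shows "A *\<^sub>v unit_vec k j = col A j"
  using assms by (intro eq_vecI) auto

text \<open>The bridge between the rank, defined as a dimension of a span of a set, and coordinates. A repeated
  column would be lost in the set of columns, so both directions have to treat distinctness separately:
  full rank leaves no room for fewer distinct columns, and equal columns contradict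
  injectivity at the difference of two unit vectors.\<close>

lemma full_rank_iff_injective:
  fixes A :: "'a :: field mat"
  assumes A: "A \<in> carrier_mat m k"
  shows "vec_space.rank m A = k \<longleftrightarrow> (\<forall>v\<in>carrier_vec k. A *\<^sub>v v = 0\<^sub>v m \<longrightarrow> v = 0\<^sub>v k)"
proof -
  interpret vec_space "TYPE('a)" m .
  show ?thesis
  proof
    assume rk: "rank A = k"
    obtain S where S: "finite S" "maximal S (\<lambda>T. T \<subseteq> set (cols A) \<and> lin_indpt T)"
      using maximal_exists_superset[of "set (cols A)" "\<lambda>T. T \<subseteq> set (cols A) \<and> lin_indpt T" "{}"]
      by (auto simp: lin_dep_def)
    have "card S = k" using rank_card_indpt[OF A S(2)] rk by simp
    moreover have "card S \<le> card (set (cols A))" using S by (simp add: card_mono maximal_def)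
    ultimately have "card (set (cols A)) = length (cols A)" using card_length[of "cols A"] A by simp
    hence dist: "distinct (cols A)" by (rule card_distinct)
    show "\<forall>v\<in>carrier_vec k. A *\<^sub>v v = 0\<^sub>v m \<longrightarrow> v = 0\<^sub>v k"
      using lin_depI[OF A _ _ _ dist] full_rank_lin_indpt[OF A rk dist] by blast
  next
    assume inj: "\<forall>v\<in>carrier_vec k. A *\<^sub>v v = 0\<^sub>v m \<longrightarrow> v = 0\<^sub>v k"
    have dist: "distinct (cols A)"
      unfolding distinct_conv_nth
    proof (intro allI impI notI)
      fix i j assume "i < length (cols A)" "j < length (cols A)" and ij: "i \<noteq> j"
        and eq: "cols A ! i = cols A ! j"
      hence k: "i < k" "j < k" using A by auto
      let ?v = "unit_vec k i - unit_vec k j :: 'a vec"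
      have "A *\<^sub>v ?v = A *\<^sub>v unit_vec k i - A *\<^sub>v unit_vec k j"
        by (rule mult_minus_distrib_mat_vec[OF A]) auto
      also have "\<dots> = 0\<^sub>v m" using eq k A by (simp add: mult_mat_unit_vec[OF A])
      finally have "?v = 0\<^sub>v k" using inj by simp
      hence "?v $ i = 0" using k by simp
      thus False using k ij by simp
    qed
    have "lin_indpt (set (cols A))"
    proof
      assume "lin_dep (set (cols A))"
      from lin_depE[OF A this dist] show False using inj by blast
    qed
    thus "rank A = k" by (rule lin_indpt_full_rank[OF A dist])
  qed
qed

lemma full_rank_GL_mult:
  assumes g: "g \<in> carrier (GL m)" and A: "A \<in> carrier_mat m k" and rk: "vec_space.rank m A = k"
  shows "vec_space.rank m (g * A) = k"
proof -
  note gc = GL_dim[OF g]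
  have gA: "g * A \<in> carrier_mat m k" using gc A by simp
  have "v = 0\<^sub>v k" if v: "v \<in> carrier_vec k" "g * A *\<^sub>v v = 0\<^sub>v m" for v
  proof -
    have "g *\<^sub>v (A *\<^sub>v v) = 0\<^sub>v m" using v assoc_mult_mat_vec[OF gc A v(1)] by simp
    hence "A *\<^sub>v v = 0\<^sub>v m"
      using det_0_iff_vec_prod_zero_field[OF gc] g mult_mat_vec_carrier[OF A v(1)]
      by (auto simp: GL_carrier_det)
    thus ?thesis using rk v(1) unfolding full_rank_iff_injective[OF A] by blast
  qed
  thus ?thesis unfolding full_rank_iff_injective[OF gA] by blast
qed

lemma span_cols:
  assumes A: "A \<in> carrier_mat m k"
  shows "LinearCombinations.module.span class_ring (module_vec TYPE(complex) m) (set (cols A))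
    = act A (carrier_vec k)"
proof -
  interpret vec_space "TYPE(complex)" m .
  show ?thesis using col_space_eq[OF A] A unfolding col_space_def act_def by auto
qed

lemma column_space_in_Gr:
  assumes A: "A \<in> carrier_mat m k"
  shows "act A (carrier_vec k) \<in> Gr d m \<longleftrightarrow> vec_space.rank m A = d"
proof -
  interpret vec_space "TYPE(complex)" m .
  have "subspace class_ring (span (set (cols A))) V"
    by (rule span_is_subspace) (use A cols_dim[of A] in auto)
  thus ?thesis unfolding Gr_def rank_def span_cols[OF A] by simp
qed

lemma Gr_linear_set:
  assumes "W \<in> Gr k m"
  shows "linear_set m W"
proof -
  have "submodule class_ring W (module_vec TYPE(complex) m)"
    using assms by (simp add: Gr_def subspace_def)
  from submodule.subset[OF this] submodule.m_closed[OF this] submodule.zero_closed[OF this]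
    submodule.smult_closed[OF this]
  show ?thesis by (simp add: linear_set_def module_vec_simps class_ring_simps)
qed

section \<open>Block matrices and partial permutations\<close>

definition col_support :: "nat \<Rightarrow> complex mat \<Rightarrow> nat \<Rightarrow> nat set" where
  "col_support n \<omega> k = {r. r < n + n \<and> \<omega> $$ (r, k) \<noteq> 0}"

definition block_matrix :: "nat \<Rightarrow> nat \<Rightarrow> complex mat \<Rightarrow> bool" where
  "block_matrix n k \<omega> \<longleftrightarrow> \<omega> \<in> carrier_mat (n + n) k \<and>
     (\<forall>r<n + n. \<forall>j<k. \<omega> $$ (r, j) \<in> {0, 1}) \<and> (\<forall>j<k. block n (col_support n \<omega> j)) \<and>
     (\<forall>i<k. \<forall>j<k. i \<noteq> j \<longrightarrow> col_support n \<omega> i \<inter> col_support n \<omega> j = {})"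

definition col_supports :: "nat \<Rightarrow> complex mat \<Rightarrow> nat set set" where
  "col_supports n \<omega> = col_support n \<omega> ` {..<dim_col \<omega>}"

lemma block_matrixD:
  assumes "block_matrix n k \<omega>"
  shows "\<omega> \<in> carrier_mat (n + n) k" "dim_col \<omega> = k"
    "j < k \<Longrightarrow> block n (col_support n \<omega> j)"
    "r < n + n \<Longrightarrow> j < k \<Longrightarrow> \<omega> $$ (r, j) = (if r \<in> col_support n \<omega> j then 1 else 0)"
    "i < k \<Longrightarrow> j < k \<Longrightarrow> r \<in> col_support n \<omega> i \<Longrightarrow> r \<in> col_support n \<omega> j \<Longrightarrow> i = j"
    "r \<in> col_support n \<omega> j \<Longrightarrow> r < n + n"
proof -
  show "r < n + n \<Longrightarrow> j < k \<Longrightarrow> \<omega> $$ (r, j) = (if r \<in> col_support n \<omega> j then 1 else 0)"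
    using assms by (auto simp: block_matrix_def col_support_def)
  show "i < k \<Longrightarrow> j < k \<Longrightarrow> r \<in> col_support n \<omega> i \<Longrightarrow> r \<in> col_support n \<omega> j \<Longrightarrow> i = j"
    using assms unfolding block_matrix_def by blast
qed (use assms in \<open>auto simp: block_matrix_def col_support_def\<close>)

lemma block_matrix_inj:
  assumes w: "block_matrix n k \<omega>"
  shows "inj_on (col_support n \<omega>) {..<k}"
proof (rule inj_onI)
  fix i j assume ij: "i \<in> {..<k}" "j \<in> {..<k}" "col_support n \<omega> i = col_support n \<omega> j"
  then obtain r where "r \<in> col_support n \<omega> i"
    using block_matrixD(3)[OF w, of i] by (auto simp: block_def)
  thus "i = j" using block_matrixD(5)[OF w, of i j r] ij by simp
qed

lemma block_matrix_family:
  assumes w: "block_matrix n k \<omega>"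
  shows "block_family n (col_supports n \<omega>)"
  unfolding block_family_def
proof
  show "\<forall>D\<in>col_supports n \<omega>. block n D"
    using block_matrixD(2,3)[OF w] by (auto simp: col_supports_def)
  show "disjoint (col_supports n \<omega>)"
    unfolding disjoint_def col_supports_def using block_matrixD(2,5)[OF w] by blast
qed

text \<open>Disjoint supports mean that every row has at most one nonzero entry, so no sum remains.\<close>

lemma block_matrix_mult_vec:
  assumes w: "block_matrix n k \<omega>" and v: "v \<in> carrier_vec k"
  shows "j < k \<Longrightarrow> r \<in> col_support n \<omega> j \<Longrightarrow> (\<omega> *\<^sub>v v) $ r = v $ j"
    and "r < n + n \<Longrightarrow> r \<notin> \<Union>(col_supports n \<omega>) \<Longrightarrow> (\<omega> *\<^sub>v v) $ r = 0"
proof -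
  note w = block_matrixD[OF w]
  have idx: "(\<omega> *\<^sub>v v) $ r = (\<Sum>i<k. \<omega> $$ (r, i) * v $ i)" if "r < n + n"
    using index_mult_mat_vec_sum[OF w(1) v that] .
  show "(\<omega> *\<^sub>v v) $ r = v $ j" if j: "j < k" "r \<in> col_support n \<omega> j"
  proof -
    have r: "r < n + n" using w(6)[OF j(2)] .
    have "(\<Sum>i<k. \<omega> $$ (r, i) * v $ i) = (\<Sum>i\<in>{j}. v $ i)"
    proof (rule sum.mono_neutral_cong_right)
      show "\<forall>i\<in>{..<k} - {j}. \<omega> $$ (r, i) * v $ i = 0"
        using w(4)[OF r] w(5)[OF _ j(1) _ j(2)] by auto
      show "\<omega> $$ (r, i) * v $ i = v $ i" if "i \<in> {j}" for i
        using that w(4)[OF r j(1)] j(2) by simp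
    qed (use j in auto)
    thus ?thesis using idx[OF r] by simp
  qed
  show "(\<omega> *\<^sub>v v) $ r = 0" if r: "r < n + n" "r \<notin> \<Union>(col_supports n \<omega>)"
    unfolding idx[OF r(1)]
    by (rule sum.neutral) (use r w(2) w(4)[OF r(1)] in \<open>auto simp: col_supports_def\<close>)
qed

lemma block_matrix_image:
  assumes w: "block_matrix n k \<omega>"
  shows "act \<omega> (carrier_vec k) = block_space n (col_supports n \<omega>)"
proof (intro Set.set_eqI iffI)
  note wD = block_matrixD[OF w]
  have wv: "\<omega> *\<^sub>v v \<in> block_space n (col_supports n \<omega>)" if v: "v \<in> carrier_vec k" for v
  proof (rule block_spaceI)
    show "\<omega> *\<^sub>v v \<in> carrier_vec (n + n)" using mult_mat_vec_carrier[OF wD(1) v] .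
    show "(\<omega> *\<^sub>v v) $ r = (\<omega> *\<^sub>v v) $ s" if "D \<in> col_supports n \<omega>" "r \<in> D" "s \<in> D" for D r s
      using that block_matrix_mult_vec(1)[OF w v] wD(2) by (auto simp: col_supports_def)
  qed (use block_matrix_mult_vec(2)[OF w v] in blast)
  show "x \<in> act \<omega> (carrier_vec k) \<Longrightarrow> x \<in> block_space n (col_supports n \<omega>)" for x
    using wv by (auto simp: act_def)
  show "x \<in> act \<omega> (carrier_vec k)" if x: "x \<in> block_space n (col_supports n \<omega>)" for x
  proof -
    define v where "v = vec k (\<lambda>j. x $ (SOME r. r \<in> col_support n \<omega> j))"
    have v: "v \<in> carrier_vec k" by (simp add: v_def)
    have "x = \<omega> *\<^sub>v v"
    proof (rule eq_vecI)
      fix r assume "r < dim_vec (\<omega> *\<^sub>v v)"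
      hence r: "r < n + n" using wD(1) by simp
      show "x $ r = (\<omega> *\<^sub>v v) $ r"
      proof (cases "r \<in> \<Union>(col_supports n \<omega>)")
        case True
        then obtain j where j: "j < k" "r \<in> col_support n \<omega> j" using wD(2) by (auto simp: col_supports_def)
        have "(SOME r. r \<in> col_support n \<omega> j) \<in> col_support n \<omega> j" using j(2) by (rule someI)
        moreover have "col_support n \<omega> j \<in> col_supports n \<omega>" using j wD(2) by (auto simp: col_supports_def)
        ultimately have "v $ j = x $ r" using block_spaceD(2)[OF x _ _ j(2)] j(1) by (simp add: v_def)
        thus ?thesis using block_matrix_mult_vec(1)[OF w v j] by simp
      next
        case False
        thus ?thesis using block_spaceD(3)[OF x r] block_matrix_mult_vec(2)[OF w v r] by simp
      qed
    qed (use block_spaceD(1)[OF x] wD(1) in auto)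
    thus ?thesis using v by (auto simp: act_def)
  qed
qed

lemma block_matrix_rank:
  assumes w: "block_matrix n k \<omega>"
  shows "vec_space.rank (n + n) \<omega> = k"
  unfolding full_rank_iff_injective[OF block_matrixD(1)[OF w]]
proof (intro ballI impI)
  fix v :: "complex vec" assume v: "v \<in> carrier_vec k" and 0: "\<omega> *\<^sub>v v = 0\<^sub>v (n + n)"
  show "v = 0\<^sub>v k"
  proof (rule eq_vecI)
    fix j assume "j < dim_vec (0\<^sub>v k :: complex vec)"
    hence j: "j < k" by simp
    then obtain r where r: "r \<in> col_support n \<omega> j" using block_matrixD(3)[OF w j] by (auto simp: block_def)
    have "v $ j = (\<omega> *\<^sub>v v) $ r" using block_matrix_mult_vec(1)[OF w v j r] by simp
    thus "v $ j = 0\<^sub>v k $ j" using block_matrixD(6)[OF w r] j unfolding 0 by simp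
  qed (use v in auto)
qed

lemma block_family_matrix:
  assumes S: "block_family n S"
  shows "\<exists>\<omega>. block_matrix n (card S) \<omega> \<and> col_supports n \<omega> = S"
proof -
  have "S \<subseteq> Pow {..<n + n}" using S by (auto simp: block_family_def block_def)
  hence fin: "finite S" by (rule finite_subset) simp
  obtain f where f: "bij_betw f {..<card S} S"
    using ex_bij_betw_nat_finite[OF fin] by (auto simp: lessThan_atLeast0)
  define \<omega> where "\<omega> = mat (n + n) (card S) (\<lambda>(r, c). if r \<in> f c then 1 else 0 :: complex)"
  have fS: "f j \<in> S" if "j < card S" for j using f that by (auto simp: bij_betw_def)
  have supp: "col_support n \<omega> j = f j" if j: "j < card S" for j
    using block_family_less[OF S fS[OF j]] j by (auto simp: col_support_def \<omega>_def split: if_splits)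
  have "block_matrix n (card S) \<omega>"
    unfolding block_matrix_def
  proof (intro conjI allI impI)
    show "\<omega> \<in> carrier_mat (n + n) (card S)" by (simp add: \<omega>_def)
    show "\<omega> $$ (r, j) \<in> {0, 1}" if "r < n + n" "j < card S" for r j using that by (simp add: \<omega>_def)
    show "block n (col_support n \<omega> j)" if "j < card S" for j
      using supp[OF that] fS[OF that] S by (simp add: block_family_def)
    show "col_support n \<omega> i \<inter> col_support n \<omega> j = {}" if ij: "i < card S" "j < card S" "i \<noteq> j" for i j
    proof -
      have "f i \<noteq> f j" using f ij by (auto simp: bij_betw_def inj_on_def)
      thus ?thesis
        using supp ij fS block_family_unique[OF S fS[OF ij(1)] fS[OF ij(2)]] by auto
    qed
  qed
  moreover have "col_supports n \<omega> = S"
  proof -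
    have "col_supports n \<omega> = f ` {..<card S}"
      unfolding col_supports_def using supp by (intro image_cong) (auto simp: \<omega>_def)
    thus ?thesis using f by (simp add: bij_betw_def)
  qed
  ultimately show ?thesis by blast
qed

lemma partial_perms_iff:
  "x \<in> partial_perms n \<longleftrightarrow> x \<in> carrier_mat n n \<and> (\<forall>i<n. \<forall>j<n. x $$ (i, j) \<in> {0, 1}) \<and>
     (\<forall>i<n. \<forall>j<n. \<forall>j'<n. x $$ (i, j) \<noteq> 0 \<longrightarrow> x $$ (i, j') \<noteq> 0 \<longrightarrow> j = j') \<and>
     (\<forall>j<n. \<forall>i<n. \<forall>i'<n. x $$ (i, j) \<noteq> 0 \<longrightarrow> x $$ (i', j) \<noteq> 0 \<longrightarrow> i = i')"
proof -
  have "card {j. j < n \<and> P j} \<le> 1 \<longleftrightarrow> (\<forall>j<n. \<forall>j'<n. P j \<longrightarrow> P j' \<longrightarrow> j = j')" for P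
    using card_le_Suc0_iff_eq[of "{j. j < n \<and> P j}"] by auto
  thus ?thesis unfolding partial_perms_def by simp
qed

text \<open>The column conditions of the two partial permutations say that a support meets each half at most
  once, and the row conditions say that supports are disjoint. That the supports are nonempty is what the rank
  condition adds.\<close>

lemma pp_pairs_block_matrix: "pp_pairs n = {\<omega>. block_matrix n n \<omega>}"
proof (intro Set.set_eqI iffI)
  fix \<omega> assume "\<omega> \<in> pp_pairs n"
  then obtain a b where a: "a \<in> partial_perms n" and b: "b \<in> partial_perms n"
    and \<omega>: "\<omega> = a @\<^sub>r b" and rk: "vec_space.rank (n + n) \<omega> = n"
    by (auto simp: pp_pairs_def)
  have car: "a \<in> carrier_mat n n" "b \<in> carrier_mat n n" using a b by (simp_all add: partial_perms_iff)
  have wc: "\<omega> \<in> carrier_mat (n + n) n" using car \<omega> by auto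
  have entry: "\<omega> $$ (r, j) = (if r < n then a $$ (r, j) else b $$ (r - n, j))"
    if "r < n + n" "j < n" for r j
    using that car by (auto simp: \<omega> append_rows_def)
  have pp1: "x $$ (i, j) \<in> {0, 1}" if "x \<in> partial_perms n" "i < n" "j < n" for x i j
    using that(1)[unfolded partial_perms_iff, THEN conjunct2, THEN conjunct1] that(2,3) by simp
  have pp2: "i = i'" if "x \<in> partial_perms n" "i < n" "j < n" "i' < n"
    "x $$ (i, j) \<noteq> 0" "x $$ (i', j) \<noteq> 0" for x i j i'
    using that(1)[unfolded partial_perms_iff, THEN conjunct2, THEN conjunct2, THEN conjunct2] that(2-)
    by blast
  have pp3: "j = j'" if "x \<in> partial_perms n" "i < n" "j < n" "j' < n"
    "x $$ (i, j) \<noteq> 0" "x $$ (i, j') \<noteq> 0" for x i j j'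
    using that(1)[unfolded partial_perms_iff, THEN conjunct2, THEN conjunct2, THEN conjunct1] that(2-)
    by blast
  have "block_matrix n n \<omega>"
    unfolding block_matrix_def
  proof (intro conjI allI impI wc)
    show "\<omega> $$ (r, j) \<in> {0, 1}" if "r < n + n" "j < n" for r j
      using pp1[OF a _ that(2), of r] pp1[OF b _ that(2), of "r - n"] that
      by (simp add: entry)
    show "col_support n \<omega> i \<inter> col_support n \<omega> j = {}" if ij: "i < n" "j < n" "i \<noteq> j" for i j
    proof (rule ccontr)
      assume "col_support n \<omega> i \<inter> col_support n \<omega> j \<noteq> {}"
      then obtain r where r: "r < n + n" "\<omega> $$ (r, i) \<noteq> 0" "\<omega> $$ (r, j) \<noteq> 0"
        by (auto simp: col_support_def)
      have "r - n < n" using r(1) ij by arith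
      thus False
        using r(2,3) pp3[OF a _ ij(1,2), of r] pp3[OF b _ ij(1,2), of "r - n"] r(1) ij
        by (cases "r < n") (auto simp: entry)
    qed
    show "block n (col_support n \<omega> j)" if j: "j < n" for j
      unfolding block_def
    proof (intro conjI ballI impI)
      show "col_support n \<omega> j \<noteq> {}"
      proof
        assume "col_support n \<omega> j = {}"
        hence "\<omega> *\<^sub>v unit_vec n j = 0\<^sub>v (n + n)"
          unfolding mult_mat_unit_vec[OF wc j] using wc j by (intro eq_vecI) (auto simp: col_support_def)
        hence "unit_vec n j = (0\<^sub>v n :: complex vec)"
          using rk unfolding full_rank_iff_injective[OF wc] by simp
        thus False using j by simp
      qed
      show "col_support n \<omega> j \<subseteq> {..<n + n}" by (auto simp: col_support_def)
      fix r s assume "r \<in> col_support n \<omega> j" "s \<in> col_support n \<omega> j" and half: "(r < n) = (s < n)"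
      hence rs: "r < n + n" "s < n + n" "\<omega> $$ (r, j) \<noteq> 0" "\<omega> $$ (s, j) \<noteq> 0"
        by (auto simp: col_support_def)
      show "r = s"
      proof (cases "r < n")
        case True
        thus ?thesis using pp2[OF a True j, of s] rs half j by (simp add: entry)
      next
        case False
        moreover have "r - n < n" "s - n < n" using rs(1,2) j by arith+
        ultimately have "r - n = s - n" using pp2[OF b _ j, of "r - n" "s - n"] rs half j by (simp add: entry)
        thus ?thesis using False half by simp
      qed
    qed
  qed
  thus "\<omega> \<in> {\<omega>. block_matrix n n \<omega>}" by simp
next
  fix \<omega> assume "\<omega> \<in> {\<omega>. block_matrix n n \<omega>}"
  hence bm: "block_matrix n n \<omega>" by simp
  note w = block_matrixD[OF bm]
  have half: "mat n n (\<lambda>(i, j). \<omega> $$ (i + k, j)) \<in> partial_perms n" (is "?x \<in> _")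
    if k: "k = 0 \<or> k = n" for k
  proof -
    have supp: "i + k \<in> col_support n \<omega> j" if "i < n" "?x $$ (i, j) \<noteq> 0" "j < n" for i j
      using that k by (auto simp: col_support_def)
    have 1: "?x $$ (i, j) \<in> {0, 1}" if "i < n" "j < n" for i j
      using that k w(4)[of "i + k" j] by auto
    have 2: "j = j'" if "i < n" "j < n" "j' < n" "?x $$ (i, j) \<noteq> 0" "?x $$ (i, j') \<noteq> 0" for i j j'
      using w(5)[OF that(2,3) supp[OF that(1,4,2)] supp[OF that(1,5,3)]] .
    have 3: "i = i'" if "i < n" "i' < n" "j < n" "?x $$ (i, j) \<noteq> 0" "?x $$ (i', j) \<noteq> 0" for i i' j
    proof -
      have "i + k \<in> col_support n \<omega> j" "i' + k \<in> col_support n \<omega> j" using supp that by blast+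
      moreover have "(i + k < n) = (i' + k < n)" using k that by auto
      ultimately have "i + k = i' + k" using w(3)[OF that(3)] unfolding block_def by blast
      thus ?thesis by simp
    qed
    have "?x \<in> carrier_mat n n" by simp
    thus ?thesis unfolding partial_perms_iff using 1 2 3 by blast
  qed
  let ?a = "mat n n (\<lambda>(i, j). \<omega> $$ (i + 0, j))" and ?b = "mat n n (\<lambda>(i, j). \<omega> $$ (i + n, j))"
  have eq: "?a @\<^sub>r ?b = \<omega>"
    using w(1) by (intro eq_matI) (auto simp: append_rows_def)
  have "vec_space.rank (n + n) (?a @\<^sub>r ?b) = n" unfolding eq by (rule block_matrix_rank[OF bm])
  moreover have "?a \<in> partial_perms n" "?b \<in> partial_perms n" using half[of 0] half[of n] by blast+
  ultimately have "?a @\<^sub>r ?b \<in> pp_pairs n" unfolding pp_pairs_def by blast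
  thus "\<omega> \<in> pp_pairs n" unfolding eq .
qed

lemma index_mult_perm_mat:
  assumes w: "\<omega> \<in> carrier_mat m n" and p: "p permutes {..<n}" and "r < m" "j < n"
  shows "(\<omega> * perm_mat n p) $$ (r, j) = \<omega> $$ (r, p j)"
proof -
  have pj: "p j < n" using permutes_in_image[OF p, of j] assms(4) by simp
  have "(\<omega> * perm_mat n p) $$ (r, j) = (\<Sum>i<n. \<omega> $$ (r, i) * (if i = p j then 1 else 0))"
    using assms by (auto simp: perm_mat_def scalar_prod_def lessThan_atLeast0 intro!: sum.cong)
  also have "\<dots> = (\<Sum>i\<in>{p j}. \<omega> $$ (r, i))"
    using pj by (intro sum.mono_neutral_cong_right) auto
  finally show ?thesis by simp
qed

text \<open>The supports of distinct columns are distinct, so two lists of supports with the same set of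
  entries are permutations of each other; entries in \<open>{0, 1}\<close> are determined by the supports.\<close>

lemma col_supports_eq_iff:
  assumes w: "block_matrix n k \<omega>" and w': "block_matrix n k \<omega>'"
  shows "col_supports n \<omega> = col_supports n \<omega>' \<longleftrightarrow> (\<exists>p. p permutes {..<k} \<and> \<omega>' = \<omega> * perm_mat k p)"
proof
  note wD = block_matrixD[OF w] and wD' = block_matrixD[OF w']
  assume eq: "col_supports n \<omega> = col_supports n \<omega>'"
  let ?xs = "map (col_support n \<omega>) [0..<k]" and ?ys = "map (col_support n \<omega>') [0..<k]"
  have "distinct ?xs" "distinct ?ys"
    using block_matrix_inj[OF w] block_matrix_inj[OF w'] by (auto simp: distinct_map lessThan_atLeast0)
  moreover have "set ?ys = set ?xs"
    using eq wD(2) wD'(2) by (simp add: col_supports_def lessThan_atLeast0)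
  ultimately have "mset ?ys = mset ?xs" using set_eq_iff_mset_eq_distinct by blast
  then obtain p where p: "p permutes {..<length ?xs}" "permute_list p ?xs = ?ys"
    by (rule mset_eq_permutation)
  hence p1: "p permutes {..<k}" by simp
  have supp: "col_support n \<omega>' j = col_support n \<omega> (p j)" if "j < k" for j
  proof -
    have "?ys ! j = ?xs ! p j" using permute_list_nth[OF p(1), of j] p(2) that by simp
    moreover have "p j < k" using permutes_in_image[OF p1, of j] that by simp
    ultimately show ?thesis using that by simp
  qed
  have "\<omega>' = \<omega> * perm_mat k p"
  proof (rule eq_matI)
    fix r j assume "r < dim_row (\<omega> * perm_mat k p)" "j < dim_col (\<omega> * perm_mat k p)"
    hence rj: "r < n + n" "j < k" using wD(1) by (auto simp: perm_mat_def)
    have "p j < k" using permutes_in_image[OF p1, of j] rj by simp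
    thus "\<omega>' $$ (r, j) = (\<omega> * perm_mat k p) $$ (r, j)"
      unfolding index_mult_perm_mat[OF wD(1) p1 rj]
      using wD(4)[OF rj(1), of "p j"] wD'(4)[OF rj] supp[OF rj(2)] by simp
  qed (use wD(1) wD'(1) in \<open>auto simp: perm_mat_def\<close>)
  thus "\<exists>p. p permutes {..<k} \<and> \<omega>' = \<omega> * perm_mat k p" using p1 by blast
next
  note wD = block_matrixD[OF w] and wD' = block_matrixD[OF w']
  assume "\<exists>p. p permutes {..<k} \<and> \<omega>' = \<omega> * perm_mat k p"
  then obtain p where p: "p permutes {..<k}" "\<omega>' = \<omega> * perm_mat k p" by blast
  have "col_support n \<omega>' j = col_support n \<omega> (p j)" if "j < k" for j
    using index_mult_perm_mat[OF wD(1) p(1) _ that] unfolding col_support_def p(2) by auto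
  hence "col_supports n \<omega>' = col_support n \<omega> ` p ` {..<k}"
    unfolding col_supports_def wD'(2) image_image by (intro image_cong) auto
  thus "col_supports n \<omega> = col_supports n \<omega>'"
    unfolding col_supports_def wD(2) permutes_image[OF p(1)] by simp
qed

section \<open>Transitivity on the Grassmannian\<close>

text \<open>The \<open>2n \<times> n\<close> matrix whose columns span the base point \<open>std_sub n\<close> of the Grassmannian.\<close>

definition std_matrix :: "nat \<Rightarrow> complex mat" where
  "std_matrix n = mat (n + n) n (\<lambda>(i, j). if i = j then 1 else 0)"

lemma std_matrix_mult_vec:
  assumes "u \<in> carrier_vec n"
  shows "std_matrix n *\<^sub>v u = u @\<^sub>v 0\<^sub>v n"
proof (rule eq_vecI)
  fix r assume "r < dim_vec (u @\<^sub>v 0\<^sub>v n)"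
  hence r: "r < n + n" using assms by simp
  have "(std_matrix n *\<^sub>v u) $ r = (\<Sum>i<n. std_matrix n $$ (r, i) * u $ i)"
    by (rule index_mult_mat_vec_sum) (use assms r in \<open>auto simp: std_matrix_def\<close>)
  also have "\<dots> = (\<Sum>i<n. if r = i then u $ i else 0)"
    using r by (intro sum.cong) (auto simp: std_matrix_def)
  also have "\<dots> = (u @\<^sub>v 0\<^sub>v n) $ r" using assms r by simp
  finally show "(std_matrix n *\<^sub>v u) $ r = (u @\<^sub>v 0\<^sub>v n) $ r" .
qed (use assms in \<open>auto simp: std_matrix_def\<close>)

lemma std_sub_image: "std_sub n = act (std_matrix n) (carrier_vec n)"
  unfolding std_sub_def act_def using std_matrix_mult_vec by (auto simp: image_def)

lemma act_column_space:
  assumes "g \<in> carrier_mat m m" "A \<in> carrier_mat m k"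
  shows "act g (act A (carrier_vec k)) = act (g * A) (carrier_vec k)"
  unfolding act_def image_image
  by (rule image_cong) (use assms in \<open>auto intro!: assoc_mult_mat_vec[symmetric]\<close>)

lemma act_std_sub:
  assumes g: "g \<in> carrier_mat (n + n) (n + n)"
  shows "act g (std_sub n) = act (g * std_matrix n) (carrier_vec n)"
  unfolding std_sub_image by (rule act_column_space[OF g]) (simp add: std_matrix_def)

lemma std_matrix_injective:
  assumes "v \<in> carrier_vec n" "std_matrix n *\<^sub>v v = 0\<^sub>v (n + n)"
  shows "v = 0\<^sub>v n"
proof (rule eq_vecI)
  fix j assume j: "j < dim_vec (0\<^sub>v n :: complex vec)"
  have "v $ j = (v @\<^sub>v 0\<^sub>v n) $ j" using j assms(1) by simp
  also have "\<dots> = 0" using assms(2) j unfolding std_matrix_mult_vec[OF assms(1)] by simp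
  finally show "v $ j = 0\<^sub>v n $ j" using j by simp
qed (use assms in auto)

lemma act_std_sub_in_Gr:
  assumes g: "g \<in> carrier (GL (n + n))"
  shows "act g (std_sub n) \<in> Gr n (n + n)"
proof -
  note gc = GL_dim[OF g]
  have E: "std_matrix n \<in> carrier_mat (n + n) n" by (simp add: std_matrix_def)
  have "vec_space.rank (n + n) (std_matrix n) = n"
    using std_matrix_injective unfolding full_rank_iff_injective[OF E] by blast
  thus ?thesis
    using full_rank_GL_mult[OF g E] column_space_in_Gr[OF mult_carrier_mat[OF gc E]]
    by (simp add: act_std_sub[OF gc])
qed

text \<open>Choose a row \<open>\<sigma> k\<close> in the support of each column \<open>k\<close> and append to \<open>\<omega>\<close> the unit vectors of the \<open>n\<close>
  rows that were not chosen. A vector in the kernel has first \<open>n\<close> coordinates zero, by the chosen rows, and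
  then the other ones, by the remaining rows.\<close>

lemma block_matrix_completion:
  assumes bm: "block_matrix n n \<omega>"
  shows "\<exists>h\<in>carrier (GL (n + n)). act h (std_sub n) = act \<omega> (carrier_vec n)"
proof -
  let ?m = "n + n"
  note w = block_matrixD[OF bm]
  define \<sigma> where "\<sigma> k = (SOME r. r \<in> col_support n \<omega> k)" for k
  have \<sigma>: "\<sigma> k \<in> col_support n \<omega> k" if "k < n" for k
    using w(3)[OF that] unfolding \<sigma>_def by (intro some_in_eq[THEN iffD2]) (simp add: block_def)
  have \<sigma>m: "\<sigma> k < ?m" if "k < n" for k using w(6)[OF \<sigma>[OF that]] .
  have inj: "inj_on \<sigma> {..<n}" using \<sigma> w(5) by (intro inj_onI) (metis lessThan_iff)
  let ?T = "{..<?m} - \<sigma> ` {..<n}"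
  have "card ?T = n" using \<sigma>m card_image[OF inj] by (subst card_Diff_subset) auto
  then obtain \<tau> where \<tau>: "bij_betw \<tau> {..<n} ?T"
    using ex_bij_betw_nat_finite[of ?T] by (auto simp: lessThan_atLeast0)
  have \<tau>T: "\<tau> j < ?m" "\<And>k. k < n \<Longrightarrow> \<tau> j \<noteq> \<sigma> k" if "j < n" for j
    using bij_betwE[OF \<tau>] that by blast+
  have \<tau>inj: "\<tau> i = \<tau> j \<longleftrightarrow> i = j" if "i < n" "j < n" for i j
    using bij_betw_imp_inj_on[OF \<tau>] that by (auto simp: inj_on_def)
  define h where "h = mat ?m ?m (\<lambda>(r, c). if c < n then \<omega> $$ (r, c) else if r = \<tau> (c - n) then 1 else 0)"
  have hc: "h \<in> carrier_mat ?m ?m" by (simp add: h_def)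
  have "v = 0\<^sub>v ?m" if v: "v \<in> carrier_vec ?m" and 0: "h *\<^sub>v v = 0\<^sub>v ?m" for v
  proof -
    have row: "(\<Sum>c<?m. h $$ (r, c) * v $ c) = 0" if "r < ?m" for r
      using index_mult_mat_vec_sum[OF hc v that] that by (simp add: 0)
    have low: "v $ k = 0" if k: "k < n" for k
    proof -
      have "(\<Sum>c<?m. h $$ (\<sigma> k, c) * v $ c) = (\<Sum>c\<in>{k}. v $ c)"
      proof (rule sum.mono_neutral_cong_right)
        show "\<forall>c\<in>{..<?m} - {k}. h $$ (\<sigma> k, c) * v $ c = 0"
        proof
          fix c assume c: "c \<in> {..<?m} - {k}"
          show "h $$ (\<sigma> k, c) * v $ c = 0"
          proof (cases "c < n")
            case True
            hence "\<sigma> k \<notin> col_support n \<omega> c" using w(5)[OF True k _ \<sigma>[OF k]] c by blast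
            thus ?thesis using w(4)[OF \<sigma>m[OF k] True] \<sigma>m[OF k] c True by (simp add: h_def)
          next
            case False
            moreover have "c - n < n" using False c by auto
            ultimately show ?thesis using \<tau>T(2)[of "c - n" k] k \<sigma>m[OF k] c by (auto simp: h_def)
          qed
        qed
        show "h $$ (\<sigma> k, c) * v $ c = v $ c" if "c \<in> {k}" for c
          using that w(4)[OF \<sigma>m[OF k] k] \<sigma>[OF k] \<sigma>m[OF k] k by (simp add: h_def)
      qed (use k in auto)
      thus ?thesis using row[OF \<sigma>m[OF k]] by simp
    qed
    have high: "v $ (n + j) = 0" if j: "j < n" for j
    proof -
      have "(\<Sum>c<?m. h $$ (\<tau> j, c) * v $ c) = (\<Sum>c\<in>{n + j}. v $ c)"
      proof (rule sum.mono_neutral_cong_right)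
        show "\<forall>c\<in>{..<?m} - {n + j}. h $$ (\<tau> j, c) * v $ c = 0"
        proof
          fix c assume c: "c \<in> {..<?m} - {n + j}"
          show "h $$ (\<tau> j, c) * v $ c = 0"
          proof (cases "c < n")
            case True
            thus ?thesis using low by simp
          next
            case False
            hence "c - n < n" "j \<noteq> c - n" using c by auto
            thus ?thesis using \<tau>inj[OF j, of "c - n"] \<tau>T(1)[OF j] c False by (simp add: h_def)
          qed
        qed
      qed (use j \<tau>T(1)[OF j] in \<open>auto simp: h_def\<close>)
      thus ?thesis using row[OF \<tau>T(1)[OF j]] by simp
    qed
    show ?thesis
    proof (rule eq_vecI)
      fix c assume c: "c < dim_vec (0\<^sub>v ?m :: complex vec)"
      show "v $ c = 0\<^sub>v ?m $ c"
        using low[of c] high[of "c - n"] c by (cases "c < n") (auto simp: less_diff_conv2)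
    qed (use v in auto)
  qed
  hence h: "h \<in> carrier (GL ?m)"
    using det_0_iff_vec_prod_zero_field[OF hc] hc by (auto simp: GL_carrier_det)
  have "h * std_matrix n = \<omega>"
  proof (rule eq_matI)
    fix r j assume "r < dim_row \<omega>" "j < dim_col \<omega>"
    hence rj: "r < ?m" "j < n" using w(1) by auto
    have "(h * std_matrix n) $$ (r, j) = (\<Sum>i<?m. h $$ (r, i) * (if i = j then 1 else 0))"
      using rj hc by (auto simp: std_matrix_def scalar_prod_def lessThan_atLeast0 intro!: sum.cong)
    also have "\<dots> = (\<Sum>i\<in>{j}. h $$ (r, i))" using rj by (intro sum.mono_neutral_cong_right) auto
    finally show "(h * std_matrix n) $$ (r, j) = \<omega> $$ (r, j)" using rj by (simp add: h_def)
  qed (use w(1) in \<open>auto simp: h_def std_matrix_def\<close>)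
  thus ?thesis using h act_std_sub[OF hc] by auto
qed

section \<open>Orbits on the Grassmannian\<close>

lemma orbit_eq_iff:
  assumes G: "group G"
    and mult: "\<And>g h z. g \<in> carrier G \<Longrightarrow> h \<in> carrier G \<Longrightarrow> z \<in> X \<Longrightarrow> \<phi> (g \<otimes>\<^bsub>G\<^esub> h) z = \<phi> g (\<phi> h z)"
    and one: "\<And>z. z \<in> X \<Longrightarrow> \<phi> \<one>\<^bsub>G\<^esub> z = z"
    and x: "x \<in> X" and y: "y \<in> X"
  shows "orbit G \<phi> x = orbit G \<phi> y \<longleftrightarrow> (\<exists>g\<in>carrier G. y = \<phi> g x)"
proof
  interpret group G by (rule G)
  assume "orbit G \<phi> x = orbit G \<phi> y"
  moreover have "y \<in> orbit G \<phi> y" unfolding orbit_def using one[OF y] one_closed by force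
  ultimately show "\<exists>g\<in>carrier G. y = \<phi> g x" unfolding orbit_def by blast
next
  interpret group G by (rule G)
  assume "\<exists>g\<in>carrier G. y = \<phi> g x"
  then obtain g where g: "g \<in> carrier G" and yg: "y = \<phi> g x" by blast
  have "\<phi> h y \<in> orbit G \<phi> x" if h: "h \<in> carrier G" for h
  proof -
    have "\<phi> h y = \<phi> (h \<otimes>\<^bsub>G\<^esub> g) x" using mult[OF h g x] yg by simp
    thus ?thesis unfolding orbit_def using m_closed[OF h g] by blast
  qed
  moreover have "\<phi> h x \<in> orbit G \<phi> y" if h: "h \<in> carrier G" for h
  proof -
    have hg: "h \<otimes>\<^bsub>G\<^esub> inv\<^bsub>G\<^esub> g \<in> carrier G" using h g by simp
    have "\<phi> h x = \<phi> (h \<otimes>\<^bsub>G\<^esub> inv\<^bsub>G\<^esub> g) y"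
      using mult[OF hg g x] h g yg by (simp add: m_assoc)
    thus ?thesis unfolding orbit_def using hg by blast
  qed
  ultimately show "orbit G \<phi> x = orbit G \<phi> y" unfolding orbit_def by blast
qed

text \<open>Two maps on \<open>X\<close> with the same fibres have images in bijection over \<open>X\<close>. Both bijections of the
  theorem arise in this way.\<close>

lemma bij_betw_induced:
  assumes "\<And>x y. x \<in> X \<Longrightarrow> y \<in> X \<Longrightarrow> F x = F y \<longleftrightarrow> G x = G y"
  shows "\<exists>\<Psi>. bij_betw \<Psi> (F ` X) (G ` X) \<and> (\<forall>x\<in>X. \<Psi> (F x) = G x)"
proof -
  define \<Psi> where "\<Psi> q = G (SOME x. x \<in> X \<and> F x = q)" for q
  have val: "\<Psi> (F x) = G x" if "x \<in> X" for x
  proof -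
    have "(SOME y. y \<in> X \<and> F y = F x) \<in> X \<and> F (SOME y. y \<in> X \<and> F y = F x) = F x"
      by (rule someI[where x = x]) (use that in simp)
    thus ?thesis using assms that unfolding \<Psi>_def by blast
  qed
  have "bij_betw \<Psi> (F ` X) (G ` X)"
    unfolding bij_betw_def inj_on_def using val assms by (auto simp: image_image)
  thus ?thesis using val by blast
qed

lemma BK_orbit_eq_iff:
  assumes W: "W \<subseteq> carrier_vec (n + n)" "W' \<subseteq> carrier_vec (n + n)"
  shows "orbit (BK_grp n) act W = orbit (BK_grp n) act W' \<longleftrightarrow> (\<exists>g\<in>BK_set n. W' = act g W)"
proof -
  have "group (BK_grp n)" by (rule subgroup.subgroup_is_group[OF subgroup_BK GL_group])
  from orbit_eq_iff[OF this, of "Pow (carrier_vec (n + n))" act W W']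
  show ?thesis using W act_mult[OF GL_dim[OF BK_GL] GL_dim[OF BK_GL]] act_one by (simp add: GL_simps)
qed

lemma Im_span_block_space:
  assumes "\<omega> \<in> pp_pairs n"
  shows "Im_span n \<omega> = block_space n (col_supports n \<omega>)" "Im_span n \<omega> \<in> Gr n (n + n)"
proof -
  have w: "block_matrix n n \<omega>" using assms by (simp add: pp_pairs_block_matrix)
  have im: "Im_span n \<omega> = act \<omega> (carrier_vec n)"
    unfolding Im_span_def by (rule span_cols[OF block_matrixD(1)[OF w]])
  show "Im_span n \<omega> = block_space n (col_supports n \<omega>)"
    unfolding im by (rule block_matrix_image[OF w])
  show "Im_span n \<omega> \<in> Gr n (n + n)"
    unfolding im column_space_in_Gr[OF block_matrixD(1)[OF w]] by (rule block_matrix_rank[OF w])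
qed

text \<open>The normal form holds for subspaces of any dimension; the dimension enters only to count the blocks.\<close>

lemma Gr_normal_form:
  assumes W: "W \<in> Gr n (n + n)"
  shows "\<exists>\<omega>\<in>pp_pairs n. \<exists>g\<in>BK_set n. W = act g (Im_span n \<omega>)"
proof -
  obtain g S where g: "g \<in> BK_set n" and S: "block_family n S" and Wg: "W = act g (block_space n S)"
    using BK_normal_form[OF order_refl Gr_linear_set[OF W]] by auto
  obtain \<omega> where w: "block_matrix n (card S) \<omega>" "col_supports n \<omega> = S"
    using block_family_matrix[OF S] by blast
  note wc = block_matrixD(1)[OF w(1)] and gG = BK_GL[OF g]
  have "W = act (g * \<omega>) (carrier_vec (card S))"
    unfolding Wg w(2)[symmetric] block_matrix_image[OF w(1), symmetric]
    using act_column_space[OF GL_dim[OF gG] wc] w(2) by simp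
  hence "vec_space.rank (n + n) (g * \<omega>) = n"
    using W column_space_in_Gr[OF mult_carrier_mat[OF GL_dim[OF gG] wc]] by simp
  hence "card S = n" using full_rank_GL_mult[OF gG wc block_matrix_rank[OF w(1)]] by simp
  hence \<omega>: "\<omega> \<in> pp_pairs n" using w(1) by (simp add: pp_pairs_block_matrix)
  have "W = act g (Im_span n \<omega>)" using Wg Im_span_block_space(1)[OF \<omega>] w(2) by simp
  thus ?thesis using g \<omega> by blast
qed

lemma BK_orbit_Im_span_eq_iff:
  assumes w: "\<omega> \<in> pp_pairs n" "\<omega>' \<in> pp_pairs n"
  shows "orbit (BK_grp n) act (Im_span n \<omega>) = orbit (BK_grp n) act (Im_span n \<omega>') \<longleftrightarrow>
    (\<exists>p. p permutes {..<n} \<and> \<omega>' = \<omega> * perm_mat n p)"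
proof -
  have bm: "block_matrix n n \<omega>" "block_matrix n n \<omega>'" using w by (simp_all add: pp_pairs_block_matrix)
  note im = Im_span_block_space(1)[OF w(1)] Im_span_block_space(1)[OF w(2)]
  note fam = block_matrix_family[OF bm(1)] block_matrix_family[OF bm(2)]
  note sub = linear_setD(1)[OF block_space_linear[OF fam(1)]] linear_setD(1)[OF block_space_linear[OF fam(2)]]
  have "orbit (BK_grp n) act (Im_span n \<omega>) = orbit (BK_grp n) act (Im_span n \<omega>') \<longleftrightarrow>
      (\<exists>g\<in>BK_set n. block_space n (col_supports n \<omega>') = act g (block_space n (col_supports n \<omega>)))"
    unfolding im by (rule BK_orbit_eq_iff[OF sub])
  also have "\<dots> \<longleftrightarrow> col_supports n \<omega> = col_supports n \<omega>'"
  proof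
    assume "\<exists>g\<in>BK_set n. block_space n (col_supports n \<omega>') = act g (block_space n (col_supports n \<omega>))"
    thus "col_supports n \<omega> = col_supports n \<omega>'"
      using blocks_of_act[OF _ sub(1)] blocks_of_block_space fam by metis
  next
    assume "col_supports n \<omega> = col_supports n \<omega>'"
    thus "\<exists>g\<in>BK_set n. block_space n (col_supports n \<omega>') = act g (block_space n (col_supports n \<omega>))"
      using act_one[OF sub(1)] subgroup.one_closed[OF subgroup_BK] by (metis GL_simps(2))
  qed
  finally show ?thesis unfolding col_supports_eq_iff[OF bm] .
qed

section \<open>Orbits on the double flag variety\<close>

lemma coset_of_act:
  assumes k: "k \<in> carrier (GL (n + n))" and W: "W \<subseteq> carrier_vec (n + n)"
  shows "(*) k ` coset_of n W = coset_of n (act k W)"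
proof (intro Set.set_eqI iffI)
  let ?m = "n + n" and ?ki = "inv\<^bsub>GL (n + n)\<^esub> k"
  note ki = GL_inv[OF k] and E = std_sub_carrier[of n]
  fix x
  show "x \<in> coset_of n (act k W)" if "x \<in> (*) k ` coset_of n W"
    using that GL_mult[OF k] act_mult[OF GL_dim[OF k] GL_dim E] by (auto simp: coset_of_def)
  assume x: "x \<in> coset_of n (act k W)"
  hence xG: "x \<in> carrier (GL ?m)" and xW: "act x (std_sub n) = act k W" by (auto simp: coset_of_def)
  have "act (?ki * x) (std_sub n) = W"
    using act_mult[OF GL_dim[OF ki(1)] GL_dim[OF xG] E] xW act_inverse(1)[OF k W] by simp
  hence "?ki * x \<in> coset_of n W" using GL_mult[OF ki(1) xG] by (simp add: coset_of_def)
  moreover have "x = k * (?ki * x)"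
    using assoc_mult_mat[OF GL_dim[OF k] GL_dim[OF ki(1)] GL_dim[OF xG]] ki(3) GL_dim[OF xG] by simp
  ultimately show "x \<in> (*) k ` coset_of n W" by blast
qed

lemma lcoset_image: "k <#\<^bsub>K_grp n\<^esub> C = (*) k ` C" "k <#\<^bsub>GL m\<^esub> D = (*) k ` D"
  by (auto simp: l_coset_def GL_simps)

lemma Gr_transitive:
  assumes W: "W \<in> Gr n (n + n)"
  shows "\<exists>g\<in>carrier (GL (n + n)). act g (std_sub n) = W"
proof -
  obtain \<omega> g where w: "\<omega> \<in> pp_pairs n" and g: "g \<in> BK_set n" and Wg: "W = act g (Im_span n \<omega>)"
    using Gr_normal_form[OF W] by blast
  have bm: "block_matrix n n \<omega>" using w by (simp add: pp_pairs_block_matrix)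
  obtain h where h: "h \<in> carrier (GL (n + n))" "act h (std_sub n) = act \<omega> (carrier_vec n)"
    using block_matrix_completion[OF bm] by blast
  have "act (g * h) (std_sub n) = W"
    using act_mult[OF GL_dim[OF BK_GL[OF g]] GL_dim[OF h(1)] std_sub_carrier] h(2) Wg
      span_cols[OF block_matrixD(1)[OF bm]] by (simp add: Im_span_def)
  moreover have "g * h \<in> carrier (GL (n + n))"
    by (rule GL_mult[OF BK_GL[OF g] h(1)])
  ultimately show ?thesis by blast
qed

text \<open>The stabilizer in \<open>K\<close> of the base point of \<open>K/B\<^sub>K\<close> is \<open>B\<^sub>K\<close>.\<close>

lemma BK_coset_eq_iff:
  assumes k: "k \<in> K_set n"
  shows "(*) k ` BK_set n = BK_set n \<longleftrightarrow> k \<in> BK_set n"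
proof
  have kc: "k \<in> carrier_mat (n + n) (n + n)" using GL_dim subgroup.mem_carrier[OF subgroup_K k] by blast
  have one: "1\<^sub>m (n + n) \<in> BK_set n"
    using subgroup.one_closed[OF subgroup_BK] by (simp add: GL_simps)
  show "k \<in> BK_set n" if "(*) k ` BK_set n = BK_set n"
    using that one kc by (metis imageI right_mult_one_mat)
  assume kB: "k \<in> BK_set n"
  note ki = GL_inv[OF BK_GL[OF kB]]
  have "x \<in> (*) k ` BK_set n" if x: "x \<in> BK_set n" for x
  proof -
    have "x = k * (inv\<^bsub>GL (n + n)\<^esub> k * x)"
      using assoc_mult_mat[OF kc GL_dim[OF ki(1)] GL_dim[OF BK_GL[OF x]]] ki(3) GL_dim[OF BK_GL[OF x]]
      by simp
    thus ?thesis using BK_mult[OF BK_inv[OF kB] x] by blast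
  qed
  thus "(*) k ` BK_set n = BK_set n" using BK_mult[OF kB] by blast
qed

lemma K_orbit_eq_iff:
  assumes CD: "C \<subseteq> carrier (GL (n + n))" "D \<subseteq> carrier (GL (n + n))"
    and CD': "C' \<subseteq> carrier (GL (n + n))" "D' \<subseteq> carrier (GL (n + n))"
  shows "orbit (K_grp n) (act_XX n) (C, D) = orbit (K_grp n) (act_XX n) (C', D') \<longleftrightarrow>
    (\<exists>k\<in>K_set n. C' = (*) k ` C \<and> D' = (*) k ` D)"
proof -
  let ?m = "n + n" and ?P = "Pow (carrier (GL (n + n)))"
  have K: "group (K_grp n)" by (rule subgroup.subgroup_is_group[OF subgroup_K GL_group])
  have assoc: "(*) (g * h) ` A = (*) g ` (*) h ` A"
    if "g \<in> K_set n" "h \<in> K_set n" "A \<subseteq> carrier (GL ?m)" for g h A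
    unfolding image_image
    by (rule image_cong)
      (use that GL_dim subgroup.mem_carrier[OF subgroup_K] in \<open>blast intro: assoc_mult_mat\<close>)+
  have one: "(*) (1\<^sub>m ?m) ` A = A" if "A \<subseteq> carrier (GL ?m)" for A
  proof -
    have "1\<^sub>m ?m * x = x" if "x \<in> A" for x using that \<open>A \<subseteq> _\<close> GL_dim left_mult_one_mat by blast
    thus ?thesis by (simp cong: image_cong)
  qed
  have "orbit (K_grp n) (act_XX n) (C, D) = orbit (K_grp n) (act_XX n) (C', D') \<longleftrightarrow>
      (\<exists>k\<in>carrier (K_grp n). (C', D') = act_XX n k (C, D))"
  proof (rule orbit_eq_iff[OF K, where X = "?P \<times> ?P"])
    show "act_XX n (g \<otimes>\<^bsub>K_grp n\<^esub> h) z = act_XX n g (act_XX n h z)"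
      if gh: "g \<in> carrier (K_grp n)" "h \<in> carrier (K_grp n)" and z: "z \<in> ?P \<times> ?P" for g h z
    proof -
      obtain A B where AB: "z = (A, B)" "A \<subseteq> carrier (GL ?m)" "B \<subseteq> carrier (GL ?m)" using z by auto
      show ?thesis
        using gh assoc[OF _ _ AB(2)] assoc[OF _ _ AB(3)]
        by (simp add: AB(1) act_XX_def lcoset_image GL_simps)
    qed
    show "act_XX n \<one>\<^bsub>K_grp n\<^esub> z = z" if "z \<in> ?P \<times> ?P" for z
      using that one by (auto simp: act_XX_def lcoset_image GL_simps)
  qed (use CD CD' in auto)
  thus ?thesis by (simp add: act_XX_def lcoset_image)
qed

lemma coset_of_carrier: "coset_of n W \<subseteq> carrier (GL (n + n))"
  by (auto simp: coset_of_def)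

text \<open>The orbit of \<open>(k B\<^sub>K, g P\<^sub>S)\<close> contains \<open>(B\<^sub>K, k\<^sup>-\<^sup>1 g P\<^sub>S)\<close>, whose second entry is the coset of
  a point of the Grassmannian. Conversely every point of the Grassmannian occurs, by transitivity.\<close>

lemma orbits_XX:
  "orbits (K_grp n) (XX n) (act_XX n)
    = (\<lambda>W. orbit (K_grp n) (act_XX n) (BK_set n, coset_of n W)) ` Gr n (n + n)"
proof (intro Set.set_eqI iffI)
  let ?m = "n + n"
  note KG = subgroup.mem_carrier[OF subgroup_K]
  have BKsub: "BK_set n \<subseteq> carrier (GL ?m)" using BK_GL by blast
  fix Q assume "Q \<in> orbits (K_grp n) (XX n) (act_XX n)"
  then obtain k g where k: "k \<in> K_set n" and g: "g \<in> carrier (GL ?m)"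
    and Q: "Q = orbit (K_grp n) (act_XX n) ((*) k ` BK_set n, (*) g ` P_S n)"
    by (auto simp: orbits_def XX_def LCOSETS_def lcoset_image)
  note kG = KG[OF k] and ki = GL_inv[OF KG[OF k]]
  let ?W' = "act g (std_sub n)" and ?ki = "inv\<^bsub>GL (n + n)\<^esub> k"
  let ?W = "act ?ki ?W'"
  have W': "?W' \<subseteq> carrier_vec ?m" by (rule act_carrier[OF GL_dim[OF g] std_sub_carrier])
  have kg: "?ki * g \<in> carrier (GL ?m)"
    by (rule GL_mult[OF ki(1) g])
  have "?W = act (?ki * g) (std_sub n)"
    by (rule act_mult[symmetric, OF GL_dim[OF ki(1)] GL_dim[OF g] std_sub_carrier])
  hence WGr: "?W \<in> Gr n ?m" using act_std_sub_in_Gr[OF kg] by simp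
  have "(*) g ` P_S n = coset_of n ?W'" using coset_of_act_std_sub[OF g] by (simp add: lcoset_image)
  also have "\<dots> = (*) k ` coset_of n ?W"
    using coset_of_act[OF kG linear_setD(1)[OF Gr_linear_set[OF WGr]]] act_inverse(2)[OF kG W'] by simp
  finally have D: "(*) g ` P_S n = (*) k ` coset_of n ?W" .
  have subC: "(*) k ` BK_set n \<subseteq> carrier (GL ?m)" and subD: "(*) k ` coset_of n ?W \<subseteq> carrier (GL ?m)"
    using GL_mult[OF kG] BKsub coset_of_carrier by blast+
  have "orbit (K_grp n) (act_XX n) (BK_set n, coset_of n ?W) = Q"
    unfolding Q D using K_orbit_eq_iff[OF BKsub coset_of_carrier subC subD] k by blast
  thus "Q \<in> (\<lambda>W. orbit (K_grp n) (act_XX n) (BK_set n, coset_of n W)) ` Gr n ?m" using WGr by blast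
next
  let ?m = "n + n"
  fix Q assume "Q \<in> (\<lambda>W. orbit (K_grp n) (act_XX n) (BK_set n, coset_of n W)) ` Gr n ?m"
  then obtain W where W: "W \<in> Gr n ?m" and Q: "Q = orbit (K_grp n) (act_XX n) (BK_set n, coset_of n W)"
    by blast
  obtain g where g: "g \<in> carrier (GL ?m)" "act g (std_sub n) = W" using Gr_transitive[OF W] by blast
  have oneK: "1\<^sub>m ?m \<in> K_set n" using subgroup.one_closed[OF subgroup_K] by (simp add: GL_simps)
  have oneB: "1\<^sub>m ?m \<in> BK_set n" using subgroup.one_closed[OF subgroup_BK] by (simp add: GL_simps)
  have "BK_set n = 1\<^sub>m ?m <#\<^bsub>K_grp n\<^esub> BK_set n"
    unfolding lcoset_image using BK_coset_eq_iff[OF oneK] oneB by simp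
  hence "BK_set n \<in> lcosets\<^bsub>K_grp n\<^esub> (BK_set n)" using oneK unfolding LCOSETS_def by auto
  moreover have "coset_of n W \<in> lcosets\<^bsub>GL ?m\<^esub> (P_S n)"
    using coset_of_act_std_sub[OF g(1)] g unfolding LCOSETS_def by auto
  ultimately show "Q \<in> orbits (K_grp n) (XX n) (act_XX n)"
    unfolding Q orbits_def XX_def by blast
qed

text \<open>An element of \<open>K\<close> that links two points with first entry \<open>B\<^sub>K\<close> stabilizes \<open>B\<^sub>K\<close>, so it lies in \<open>B\<^sub>K\<close>.\<close>

lemma orbit_correspondence:
  assumes W: "W \<in> Gr n (n + n)" "W' \<in> Gr n (n + n)"
  shows "orbit (BK_grp n) act W = orbit (BK_grp n) act W' \<longleftrightarrow>
    orbit (K_grp n) (act_XX n) (BK_set n, coset_of n W) =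
    orbit (K_grp n) (act_XX n) (BK_set n, coset_of n W')"
proof -
  note sub = linear_setD(1)[OF Gr_linear_set[OF W(1)]] linear_setD(1)[OF Gr_linear_set[OF W(2)]]
  have BKsub: "BK_set n \<subseteq> carrier (GL (n + n))" using BK_GL by blast
  have inj: "coset_of n W' = coset_of n V \<Longrightarrow> W' = V" for V
    using Gr_transitive[OF W(2)] unfolding coset_of_def by blast
  have "orbit (K_grp n) (act_XX n) (BK_set n, coset_of n W) =
      orbit (K_grp n) (act_XX n) (BK_set n, coset_of n W') \<longleftrightarrow>
      (\<exists>k\<in>K_set n. BK_set n = (*) k ` BK_set n \<and> coset_of n W' = (*) k ` coset_of n W)"
    by (rule K_orbit_eq_iff[OF BKsub coset_of_carrier BKsub coset_of_carrier])
  also have "\<dots> \<longleftrightarrow> (\<exists>k\<in>BK_set n. coset_of n W' = coset_of n (act k W))"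
    using BK_coset_eq_iff BK_sub_K coset_of_act[OF BK_GL sub(1)] by (metis subsetD)
  also have "\<dots> \<longleftrightarrow> (\<exists>k\<in>BK_set n. W' = act k W)" using inj by blast
  finally show ?thesis using BK_orbit_eq_iff[OF sub] by simp
qed

section \<open>The classification\<close>

theorem theorem1p4:
  fixes n :: nat
  assumes "n \<ge> 1"
  shows
    "(\<forall>Q \<in> orbits (BK_grp n) (Gr n (n + n)) act.
        \<exists>\<omega> \<in> pp_pairs n. Q = orbit (BK_grp n) act (Im_span n \<omega>)) \<and>
     (\<forall>\<omega> \<in> pp_pairs n. \<forall>\<omega>' \<in> pp_pairs n.
        orbit (BK_grp n) act (Im_span n \<omega>) = orbit (BK_grp n) act (Im_span n \<omega>') \<longleftrightarrow>
        (\<exists>p. p permutes {..<n} \<and> \<omega>' = \<omega> * perm_mat n p)) \<and>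
     (\<exists>\<Phi>. bij_betw \<Phi> (pp_pairs n // col_perm_rel n) (orbits (BK_grp n) (Gr n (n + n)) act) \<and>
        (\<forall>\<omega> \<in> pp_pairs n. \<Phi> (col_perm_rel n `` {\<omega>}) = orbit (BK_grp n) act (Im_span n \<omega>))) \<and>
     (\<exists>\<Psi>. bij_betw \<Psi> (orbits (BK_grp n) (Gr n (n + n)) act) (orbits (K_grp n) (XX n) (act_XX n)) \<and>
        (\<forall>W \<in> Gr n (n + n). \<Psi> (orbit (BK_grp n) act W) =
           orbit (K_grp n) (act_XX n) (BK_set n, coset_of n W)))"
proof (intro conjI)
  let ?orb = "orbit (BK_grp n) act"
  have orbs: "orbits (BK_grp n) (Gr n (n + n)) act = ?orb ` Gr n (n + n)"
    by (auto simp: orbits_def)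
  show 1: "\<forall>Q \<in> orbits (BK_grp n) (Gr n (n + n)) act. \<exists>\<omega> \<in> pp_pairs n. Q = ?orb (Im_span n \<omega>)"
    unfolding orbs
  proof (clarify)
    fix W assume W: "W \<in> Gr n (n + n)"
    then obtain \<omega> g where w: "\<omega> \<in> pp_pairs n" and g: "g \<in> BK_set n" "W = act g (Im_span n \<omega>)"
      using Gr_normal_form by blast
    note sub = linear_setD(1)[OF Gr_linear_set]
    have "?orb (Im_span n \<omega>) = ?orb W"
      using BK_orbit_eq_iff[OF sub[OF Im_span_block_space(2)[OF w]] sub[OF W]] g by blast
    thus "\<exists>\<omega>\<in>pp_pairs n. ?orb W = ?orb (Im_span n \<omega>)" using w by metis
  qed
  show "\<forall>\<omega> \<in> pp_pairs n. \<forall>\<omega>' \<in> pp_pairs n. ?orb (Im_span n \<omega>) = ?orb (Im_span n \<omega>') \<longleftrightarrow>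
      (\<exists>p. p permutes {..<n} \<and> \<omega>' = \<omega> * perm_mat n p)"
    using BK_orbit_Im_span_eq_iff by blast
  have rel: "col_perm_rel n `` {\<omega>} = {\<omega>'\<in>pp_pairs n. ?orb (Im_span n \<omega>) = ?orb (Im_span n \<omega>')}"
    if "\<omega> \<in> pp_pairs n" for \<omega>
    using that BK_orbit_Im_span_eq_iff[OF that] by (auto simp: col_perm_rel_def)
  have "(\<lambda>\<omega>. col_perm_rel n `` {\<omega>}) ` pp_pairs n = pp_pairs n // col_perm_rel n"
    by (auto simp: quotient_def)
  moreover have "(\<lambda>\<omega>. ?orb (Im_span n \<omega>)) ` pp_pairs n = orbits (BK_grp n) (Gr n (n + n)) act"
    using 1 Im_span_block_space(2) unfolding orbs by blast
  moreover have "col_perm_rel n `` {\<omega>} = col_perm_rel n `` {\<omega>'} \<longleftrightarrow> ?orb (Im_span n \<omega>) = ?orb (Im_span n \<omega>')"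
    if w: "\<omega> \<in> pp_pairs n" "\<omega>' \<in> pp_pairs n" for \<omega> \<omega>'
    unfolding rel[OF w(1)] rel[OF w(2)] using w by auto
  ultimately show "\<exists>\<Phi>. bij_betw \<Phi> (pp_pairs n // col_perm_rel n) (orbits (BK_grp n) (Gr n (n + n)) act) \<and>
      (\<forall>\<omega> \<in> pp_pairs n. \<Phi> (col_perm_rel n `` {\<omega>}) = ?orb (Im_span n \<omega>))"
    using bij_betw_induced[of "pp_pairs n" "\<lambda>\<omega>. col_perm_rel n `` {\<omega>}" "\<lambda>\<omega>. ?orb (Im_span n \<omega>)"]
    by simp
  show "\<exists>\<Psi>. bij_betw \<Psi> (orbits (BK_grp n) (Gr n (n + n)) act) (orbits (K_grp n) (XX n) (act_XX n)) \<and>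
      (\<forall>W \<in> Gr n (n + n). \<Psi> (?orb W) = orbit (K_grp n) (act_XX n) (BK_set n, coset_of n W))"
    unfolding orbs orbits_XX by (rule bij_betw_induced) (rule orbit_correspondence)
qed

end
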